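(* Let $E$ be a directed graph with at least one vertex and let $R$ be a unital (possibly non-commutative) ring. Then the Leavitt path algebra $L_R(E)$ is prime if and only if $R$ is prime and $E$ satisfies condition (MT-3), that is, for all vertices $u,v\in E^0$ there exist a vertex $w\in E^0$, a path from $u$ to $w$ and a path from $v$ to $w$ (paths of length zero being allowed).
   Context: Rings are associative but not necessarily unital; a unital ring has a nonzero multiplicative identity. Ideals are two-sided. A ring $T$ is prime if $\{0\}$ is a proper ideal and for all ideals $A,B$ of $T$, $AB=\{0\}$ implies $A=\{0\}$ or $B=\{0\}$. A directed graph $E=(E^0,E^1,s,r)$ consists of a set $E^0$ of vertices, a set $E^1$ of edges and maps $s,r:E^1\to E^0$ (source and range); no cardinality or finiteness restrictions are imposed. A path is a sequence $f_1f_2\cdots f_n$ of edges with $r(f_i)=s(f_{i+1})$ for $1\le i\le n-1$ (a path from $s(f_1)$ to $r(f_n)$); a vertex $v$ is a path of length zero from $v$ to $v$. The Leavitt path algebra $L_R(E)$ is the (not necessarily unital) free associative $R$-algebra generated by the symbols $\{v\mid v\in E^0\}\cup\{f\mid f\in E^1\}\cup\{f^*\mid f\in E^1\}$, where elements of $R$ commute with the generators (so that elements are $R$-linear combinations of nonempty words in the generators), subject to the relations: (1) $vw=\delta_{v,w}v$ for all $v,w\in E^0$; (2) $s(f)f=fr(f)=f$ for every $f\in E^1$; (3) $r(f)f^*=f^*s(f)=f^*$ for every $f\in E^1$; (4) $f^*f'=\delta_{f,f'}r(f)$ for all $f,f'\in E^1$; (5) $\sum_{f\in E^1,\,s(f)=v}ff^*=v$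 for every $v\in E^0$ with $0<|s^{-1}(v)|<\infty$. *)

theory Defs
  imports
    "HOL-Algebra.QuotRing"
    "HOL-Algebra.Ideal_Product"
    "HOL-Algebra.Algebraic_Closure_Type"
    "HOL-Library.Poly_Mapping"
    "Graph_Theory.Digraph"
    "Graph_Theory.Arc_Walk"
begin

section \<open>Prime rings without assuming an identity\<close>

text \<open>
  The locale \<^locale>\<open>ideal\<close> requires the ambient ring to be unital. The following two
  predicates use only carrier, addition, zero and multiplication of a ring record;
  its \<^const>\<open>one\<close> field is never consulted.
\<close>

definition two_sided_ideal :: "'a set \<Rightarrow> ('a, 'm) ring_scheme \<Rightarrow> bool" where
  "two_sided_ideal I T \<longleftrightarrow>
     additive_subgroup I T \<and>
     (\<forall>a\<in>I. \<forall>x\<in>carrier T. x \<otimes>\<^bsub>T\<^esub> a \<in> I \<and> a \<otimes>\<^bsub>T\<^esub> x \<in> I)"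

definition prime_ring :: "('a, 'm) ring_scheme \<Rightarrow> bool" where
  "prime_ring T \<longleftrightarrow>
     two_sided_ideal {\<zero>\<^bsub>T\<^esub>} T \<and> {\<zero>\<^bsub>T\<^esub>} \<noteq> carrier T \<and>
     (\<forall>A B. two_sided_ideal A T \<longrightarrow> two_sided_ideal B T \<longrightarrow>
        ideal_prod T A B = {\<zero>\<^bsub>T\<^esub>} \<longrightarrow> A = {\<zero>\<^bsub>T\<^esub>} \<or> B = {\<zero>\<^bsub>T\<^esub>})"


section \<open>The free algebra\<close>

text \<open>
  Words form the free monoid, written additively as required by \<^type>\<open>poly_mapping\<close>.
  Hence \<open>'g fword \<Rightarrow>\<^sub>0 'r\<close> with its library multiplication is the unital free
  \<open>'r\<close>-algebra on \<open>'g\<close>; the scalar \<open>r\<close> is \<open>single 0 r\<close>, and words commute with scalars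
  although scalars need not commute with each other.
\<close>

datatype 'g fword = FWord (letters: "'g list")

instantiation fword :: (type) monoid_add
begin

definition zero_fword :: "'a fword" where
  "0 = FWord []"

definition plus_fword :: "'a fword \<Rightarrow> 'a fword \<Rightarrow> 'a fword" where
  "u + v = FWord (letters u @ letters v)"

instance
  by standard (simp_all add: zero_fword_def plus_fword_def)

end

definition gen :: "'g \<Rightarrow> 'g fword \<Rightarrow>\<^sub>0 'r::ring_1" where
  "gen g = Poly_Mapping.single (FWord [g]) 1"

text \<open>
  The non-unital free algebra on \<open>S\<close>: only nonempty words in letters from \<open>S\<close> occur.
\<close>

definition free_algebra :: "'g set \<Rightarrow> ('g fword \<Rightarrow>\<^sub>0 'r::ring_1) ring" where
  "free_algebra S =
     \<lparr>carrier = {p. \<forall>w\<in>Poly_Mapping.keys p. letters w \<noteq> [] \<and> set (letters w) \<subseteq> S},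
      monoid.mult = (\<lambda>p q. p * q), one = undefined, ring.zero = 0, add = (\<lambda>p q. p + q)\<rparr>"

text \<open>
  The free algebra has no identity, so a ring ideal of it need not be closed under scalars.
  Imposing relations on an \<open>'r\<close>-algebra means dividing by the scalar-closed ideal they generate.
\<close>

definition algebra_ideal ::
  "'g set \<Rightarrow> ('g fword \<Rightarrow>\<^sub>0 'r::ring_1) set \<Rightarrow> ('g fword \<Rightarrow>\<^sub>0 'r) set" where
  "algebra_ideal S P =
     \<Inter>{I. two_sided_ideal I (free_algebra S) \<and>
          (\<forall>p\<in>I. \<forall>r. Poly_Mapping.single 0 r * p \<in> I \<and> p * Poly_Mapping.single 0 r \<in> I) \<and>
          P \<subseteq> I}"


section \<open>Leavitt path algebras\<close>

datatype ('v, 'e) generator = Vert 'v | Edge 'e | Ghost 'e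

definition generators :: "('v, 'e) pre_digraph \<Rightarrow> ('v, 'e) generator set" where
  "generators E = Vert ` verts E \<union> Edge ` arcs E \<union> Ghost ` arcs E"

definition leavitt_relations ::
  "('v, 'e) pre_digraph \<Rightarrow> (('v, 'e) generator fword \<Rightarrow>\<^sub>0 'r::ring_1) set" where
  "leavitt_relations E =
     {gen (Vert v) * gen (Vert w) - (if v = w then gen (Vert v) else 0) | v w.
        v \<in> verts E \<and> w \<in> verts E}
   \<union> {gen (Vert (tail E f)) * gen (Edge f) - gen (Edge f) | f. f \<in> arcs E}
   \<union> {gen (Edge f) * gen (Vert (head E f)) - gen (Edge f) | f. f \<in> arcs E}
   \<union> {gen (Vert (head E f)) * gen (Ghost f) - gen (Ghost f) | f. f \<in> arcs E}
   \<union> {gen (Ghost f) * gen (Vert (tail E f)) - gen (Ghost f) | f. f \<in> arcs E}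
   \<union> {gen (Ghost f) * gen (Edge f') - (if f = f' then gen (Vert (head E f)) else 0) | f f'.
        f \<in> arcs E \<and> f' \<in> arcs E}
   \<union> {(\<Sum>f\<in>out_arcs E v. gen (Edge f) * gen (Ghost f)) - gen (Vert v) | v.
        v \<in> verts E \<and> finite (out_arcs E v) \<and> out_arcs E v \<noteq> {}}"

text \<open>
  The \<^const>\<open>one\<close> field of this record is meaningless, as the algebra need not be unital.
\<close>

definition leavitt_path_algebra ::
  "'r::ring_1 itself \<Rightarrow> ('v, 'e) pre_digraph \<Rightarrow> (('v, 'e) generator fword \<Rightarrow>\<^sub>0 'r) set ring" where
  "leavitt_path_algebra _ E =
     free_algebra (generators E) Quot algebra_ideal (generators E) (leavitt_relations E)"


section \<open>Condition (MT-3)\<close>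

text \<open>An \<^const>\<open>pre_digraph.awalk\<close> may repeat vertices and arcs, and may be empty.\<close>

definition MT3 :: "('v, 'e) pre_digraph \<Rightarrow> bool" where
  "MT3 E \<longleftrightarrow>
     (\<forall>u\<in>verts E. \<forall>v\<in>verts E. \<exists>w\<in>verts E.
        (\<exists>p. pre_digraph.awalk E u p w) \<and> (\<exists>q. pre_digraph.awalk E v q w))"

end

(*
  Every nonzero x in the algebra can be multiplied on both sides to an element of the form
  r v + z, where v is a vertex, r is a nonzero scalar and z has only terms of positive degree:
  multiply by edges on the right until no ghost edges are left, then cancel a path of minimal
  length from the left. Given x and y, (MT-3) moves both normal forms to a common vertex w, and
  primeness of R provides c such that their product with c in between is (r c s) w plus terms of
  positive degree, where r c s is nonzero. This is not zero, by a graded representation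
  on functions; no faithfulness of that representation is needed.
  Conversely, u L v is nonzero for vertices u and v of a prime algebra L, and L is spanned by
  products p q* of paths with a common range, so (MT-3) holds; ideals of R are tested on the
  elements r v.
*)
theory Submission
  imports Defs "HOL-Library.Countable_Set"
begin

section \<open>Rings without identity\<close>

text \<open>Multiplying a nonzero x by edges may kill it. If every edge does, then at a vertex v
  with x v nonzero the last relation excludes that v emits finitely many but at least one edge; what
  remains is a sink, where no ghost term survives, or an infinite emitter, where an edge foreign to
  the finite expression of x can be used. This is the only place where the cardinality of
  \<open>out_arcs G v\<close> enters the reduction.

  "Nonzero" has two meanings that are kept apart. Combinations of paths are nonzero as polynomials,
  where cancellation in the free monoid settles everything; nonzero modulo the relations is obtained
  only at the end, from a leading coefficient at a vertex. No basis of the algebra is constructed.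

  Scalars are not elements of the algebra, yet r and c have to be moved around in products.
  Calculations therefore take place in the unital free algebra on all letters, modulo a congruence
  defined for all polynomials.

  The representation must exist for every graph, with sinks and vertices emitting uncountably many
  edges. This explains points that carry both a list of arcs and a natural number.\<close>

locale nonunital_ring = abelian_group R for R (structure) +
  assumes m_closed [simp, intro]: "\<lbrakk>x \<in> carrier R; y \<in> carrier R\<rbrakk> \<Longrightarrow> x \<otimes> y \<in> carrier R"
    and m_assoc: "\<lbrakk>x \<in> carrier R; y \<in> carrier R; z \<in> carrier R\<rbrakk> \<Longrightarrow> (x \<otimes> y) \<otimes> z = x \<otimes> (y \<otimes> z)"
    and l_distr: "\<lbrakk>x \<in> carrier R; y \<in> carrier R; z \<in> carrier R\<rbrakk> \<Longrightarrow> (x \<oplus> y) \<otimes> z = x \<otimes> z \<oplus> y \<otimes> z"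
    and r_distr: "\<lbrakk>x \<in> carrier R; y \<in> carrier R; z \<in> carrier R\<rbrakk> \<Longrightarrow> z \<otimes> (x \<oplus> y) = z \<otimes> x \<oplus> z \<otimes> y"
begin

lemma r_null [simp]: "x \<in> carrier R \<Longrightarrow> x \<otimes> \<zero> = \<zero>"
  using r_distr[of \<zero> \<zero> x] by simp

lemma l_null [simp]: "x \<in> carrier R \<Longrightarrow> \<zero> \<otimes> x = \<zero>"
  using l_distr[of \<zero> \<zero> x] by simp

lemma l_minus: "\<lbrakk>x \<in> carrier R; y \<in> carrier R\<rbrakk> \<Longrightarrow> \<ominus> x \<otimes> y = \<ominus> (x \<otimes> y)"
  by (metis a_inv_closed l_distr l_neg l_null m_closed minus_equality)

lemma r_minus: "\<lbrakk>x \<in> carrier R; y \<in> carrier R\<rbrakk> \<Longrightarrow> x \<otimes> \<ominus> y = \<ominus> (x \<otimes> y)"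
  by (metis a_inv_closed r_distr l_neg r_null m_closed minus_equality)

lemma two_sided_idealI:
  assumes "I \<subseteq> carrier R" "\<zero> \<in> I"
    and "\<And>a b. \<lbrakk>a \<in> I; b \<in> I\<rbrakk> \<Longrightarrow> a \<oplus> b \<in> I"
    and "\<And>a. a \<in> I \<Longrightarrow> \<ominus> a \<in> I"
    and "\<And>a x. \<lbrakk>a \<in> I; x \<in> carrier R\<rbrakk> \<Longrightarrow> x \<otimes> a \<in> I"
    and "\<And>a x. \<lbrakk>a \<in> I; x \<in> carrier R\<rbrakk> \<Longrightarrow> a \<otimes> x \<in> I"
  shows "two_sided_ideal I R"
proof -
  have "subgroup I (add_monoid R)"
    using assms(1-4) by (intro add.subgroupI) (auto simp: a_inv_def)
  then show ?thesis
    unfolding two_sided_ideal_def using assms(5,6) by (auto intro: additive_subgroup.intro)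
qed

text \<open>Without an identity, an element need not lie in the span of its two-sided multiples, so
  annihilators replace principal ideals. If x T y = 0, then x lies in the ideal A of all a with a T
  y = 0, while T y lies in the right annihilator B of A, and primeness applies to A and B.\<close>

lemma prime_ring_iff:
  "prime_ring R \<longleftrightarrow> carrier R \<noteq> {\<zero>} \<and>
    (\<forall>x\<in>carrier R. \<forall>y\<in>carrier R. (\<forall>t\<in>carrier R. x \<otimes> t \<otimes> y = \<zero>) \<longrightarrow> x = \<zero> \<or> y = \<zero>)"
  (is "_ \<longleftrightarrow> ?nontriv \<and> ?elementwise")
proof
  assume prime: "prime_ring R"
  then have ne: ?nontriv
    by (auto simp: prime_ring_def)
  have prime: "A = {\<zero>} \<or> B = {\<zero>}"
    if A: "two_sided_ideal A R" and B: "two_sided_ideal B R" and AB: "\<And>a b. \<lbrakk>a \<in> A; b \<in> B\<rbrakk> \<Longrightarrow> a \<otimes> b = \<zero>"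
    for A B
  proof -
    have "z = \<zero>" if "z \<in> ideal_prod R A B" for z
      using that by induction (auto simp: AB)
    moreover have "\<zero> \<in> A" "\<zero> \<in> B"
      using A B by (auto simp: two_sided_ideal_def additive_subgroup.zero_closed)
    then have "\<zero> \<in> ideal_prod R A B"
      using ideal_prod.prod[of \<zero> A \<zero> B R] by simp
    ultimately have "ideal_prod R A B = {\<zero>}" by blast
    then show ?thesis
      using prime A B by (auto simp: prime_ring_def)
  qed
  have ?elementwise
  proof (intro ballI impI)
    fix x y assume x: "x \<in> carrier R" and y: "y \<in> carrier R" and xy: "\<forall>t\<in>carrier R. x \<otimes> t \<otimes> y = \<zero>"
    define A where "A = {a \<in> carrier R. \<forall>t\<in>carrier R. a \<otimes> t \<otimes> y = \<zero>}"
    define B where "B = {b \<in> carrier R. \<forall>a\<in>A. a \<otimes> b = \<zero>}"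
    \<comment> \<open>C takes care of B = 0: then T y = 0 only gives that y is annihilated from the
      left by the whole ring. Primeness for the pair of the ring itself and C shows C = 0.\<close>
    define C where "C = {c \<in> carrier R. \<forall>t\<in>carrier R. t \<otimes> c = \<zero>}"
    have A: "two_sided_ideal A R"
      unfolding A_def
    proof (rule two_sided_idealI; clarsimp simp: y l_distr l_minus)
      fix a u t assume *: "a \<in> carrier R" "u \<in> carrier R" "t \<in> carrier R"
      assume a: "\<forall>t\<in>carrier R. a \<otimes> t \<otimes> y = \<zero>"
      then show "a \<otimes> u \<otimes> t \<otimes> y = \<zero>"
        using * by (simp add: m_assoc)
      show "u \<otimes> a \<otimes> t \<otimes> y = \<zero>"
        using * a y by (metis m_assoc m_closed r_null)
    qed
    have AR: "a \<in> carrier R" if "a \<in> A" for a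
      using that by (simp add: A_def)
    have B: "two_sided_ideal B R"
      unfolding B_def
    proof (rule two_sided_idealI; clarsimp simp: AR r_distr r_minus)
      fix b u a assume *: "b \<in> carrier R" "u \<in> carrier R" "a \<in> A" and b: "\<forall>a\<in>A. a \<otimes> b = \<zero>"
      then show "a \<otimes> (b \<otimes> u) = \<zero>"
        by (metis AR m_assoc l_null)
      have "a \<otimes> u \<in> A"
        using A * by (auto simp: two_sided_ideal_def)
      then show "a \<otimes> (u \<otimes> b) = \<zero>"
        using * AR b by (metis m_assoc)
    qed
    have C: "two_sided_ideal C R"
      unfolding C_def
    proof (rule two_sided_idealI; clarsimp simp: r_distr r_minus)
      fix c u t assume *: "c \<in> carrier R" "u \<in> carrier R" "t \<in> carrier R"
      assume c: "\<forall>t\<in>carrier R. t \<otimes> c = \<zero>"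
      then show "t \<otimes> (c \<otimes> u) = \<zero>"
        using * by (simp flip: m_assoc)
    qed
    have "A = {\<zero>} \<or> B = {\<zero>}"
      using A B by (rule prime) (simp add: B_def)
    moreover have "x \<in> A"
      using x xy by (simp add: A_def)
    moreover have "y = \<zero>" if "B = {\<zero>}"
    proof -
      have "t \<otimes> y \<in> B" if "t \<in> carrier R" for t
        using that y unfolding B_def A_def by (auto simp flip: m_assoc)
      then have "y \<in> C"
        using y \<open>B = {\<zero>}\<close> by (auto simp: C_def)
      moreover have "two_sided_ideal (carrier R) R"
        by (rule two_sided_idealI) auto
      then have "carrier R = {\<zero>} \<or> C = {\<zero>}"
        using C by (rule prime) (simp add: C_def)
      with ne have "C = {\<zero>}" by blast
      ultimately show ?thesis by simp
    qed
    ultimately show "x = \<zero> \<or> y = \<zero>" by blast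
  qed
  with ne show "?nontriv \<and> ?elementwise" by blast
next
  assume *: "?nontriv \<and> ?elementwise"
  have "A = {\<zero>} \<or> B = {\<zero>}"
    if A: "two_sided_ideal A R" and B: "two_sided_ideal B R" and AB: "ideal_prod R A B = {\<zero>}" for A B
  proof (rule ccontr)
    have sub: "A \<subseteq> carrier R" "B \<subseteq> carrier R" "\<zero> \<in> A" "\<zero> \<in> B"
      using A B by (auto simp: two_sided_ideal_def additive_subgroup.zero_closed
          dest: additive_subgroup.a_subset)
    assume "\<not> (A = {\<zero>} \<or> B = {\<zero>})"
    then obtain a b where a: "a \<in> A" "a \<noteq> \<zero>" and b: "b \<in> B" "b \<noteq> \<zero>"
      using sub by blast
    then obtain t where t: "t \<in> carrier R" "a \<otimes> t \<otimes> b \<noteq> \<zero>"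
      using * sub by blast
    then have "a \<otimes> t \<in> A"
      using A a by (auto simp: two_sided_ideal_def)
    then show False
      using ideal_prod.prod[of "a \<otimes> t" A b B R] b t AB by auto
  qed
  moreover have "two_sided_ideal {\<zero>} R"
    by (rule two_sided_idealI) auto
  ultimately show "prime_ring R"
    using * by (auto simp: prime_ring_def)
qed

section \<open>Quotients by a two-sided ideal of a ring without identity\<close>

context
  fixes J assumes J: "two_sided_ideal J R"
begin

interpretation J: abelian_subgroup J R
  using J by (intro abelian_subgroupI3 abelian_group_axioms) (simp add: two_sided_ideal_def)

text \<open>The product in the quotient record is a union of cosets over all representatives. They
  coincide because (h + x)(k + y) differs from x y by h (k + y) + x k, which lies in J.\<close>

lemma FactRing_mult:
  assumes "x \<in> carrier R" "y \<in> carrier R"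
  shows "(J +> x) \<otimes>\<^bsub>R Quot J\<^esub> (J +> y) = J +> (x \<otimes> y)"
proof -
  have "J +> (a \<otimes> b) = J +> (x \<otimes> y)" if ab: "a \<in> J +> x" "b \<in> J +> y" for a b
  proof -
    obtain h k where h: "h \<in> J" "a = h \<oplus> x" and k: "k \<in> J" "b = k \<oplus> y"
      using ab by (auto simp: a_r_coset_defs)
    have hk: "h \<in> carrier R" "k \<in> carrier R"
      using h k J.a_subset by auto
    have eq: "a \<otimes> b = (h \<otimes> (k \<oplus> y) \<oplus> x \<otimes> k) \<oplus> x \<otimes> y"
      using hk assms unfolding h(2) k(2)
      by (subst l_distr) (auto simp: r_distr[of k y x] a_assoc)
    have "h \<otimes> (k \<oplus> y) \<oplus> x \<otimes> k \<in> J"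
      using J h k hk assms by (intro J.a_closed) (auto simp: two_sided_ideal_def)
    then have "a \<otimes> b \<in> J +> (x \<otimes> y)"
      unfolding eq by (auto simp: a_r_coset_defs)
    then show ?thesis
      using J.a_repr_independence' assms by blast
  qed
  moreover have "x \<in> J +> x" "y \<in> J +> y"
    using assms by (auto intro: J.a_rcos_self)
  ultimately have "(\<Union>a\<in>J +> x. \<Union>b\<in>J +> y. J +> (a \<otimes> b)) = J +> (x \<otimes> y)"
    by blast
  then show ?thesis
    by (simp add: FactRing_def rcoset_mult_def)
qed

lemma FactRing_nonunital_ring: "nonunital_ring (R Quot J)"
proof -
  have "comm_group (add_monoid (R Quot J))"
    using J.a_factorgroup_is_comm_group by (simp add: FactRing_def A_FactGroup_def')
  then have "abelian_group (R Quot J)"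
    by (rule comm_group_abelian_groupI)
  moreover have "carrier (R Quot J) = (+>) J ` carrier R"
    by (auto simp: FactRing_def A_RCOSETS_def')
  moreover have "(J +> x) \<oplus>\<^bsub>R Quot J\<^esub> (J +> y) = J +> (x \<oplus> y)"
    if "x \<in> carrier R" "y \<in> carrier R" for x y
    using that by (simp add: FactRing_def J.a_rcos_sum)
  ultimately show ?thesis
    by (intro nonunital_ring.intro nonunital_ring_axioms.intro)
      (auto simp: FactRing_mult m_assoc l_distr r_distr)
qed

text \<open>Translates primeness of the quotient into a condition on representatives, so that no
  later argument handles cosets.\<close>

lemma prime_ring_FactRing_iff:
  "prime_ring (R Quot J) \<longleftrightarrow> carrier R \<noteq> J \<and>
    (\<forall>x\<in>carrier R. \<forall>y\<in>carrier R. (\<forall>t\<in>carrier R. x \<otimes> t \<otimes> y \<in> J) \<longrightarrow> x \<in> J \<or> y \<in> J)"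
proof -
  interpret Q: nonunital_ring "R Quot J"
    by (rule FactRing_nonunital_ring)
  have carr: "carrier (R Quot J) = (+>) J ` carrier R"
    by (auto simp: FactRing_def A_RCOSETS_def')
  have zero: "\<zero>\<^bsub>R Quot J\<^esub> = J"
    by (simp add: FactRing_def)
  have coset: "J +> x = J \<longleftrightarrow> x \<in> J" if "x \<in> carrier R" for x
    using that by (metis J.a_rcos_const J.a_rcos_self)
  have "(+>) J ` carrier R \<noteq> {J} \<longleftrightarrow> carrier R \<noteq> J"
    using coset J.a_subset by auto
  then show ?thesis
    by (simp add: Q.prime_ring_iff carr zero FactRing_mult coset m_assoc)
qed

end

end

section \<open>The free algebra and its relation ideals\<close>

lemma letters_zero [simp]: "letters 0 = []"
  by (simp add: zero_fword_def)

lemma letters_plus [simp]: "letters (u + v) = letters u @ letters v"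
  by (simp add: plus_fword_def)

lemma letters_eq_Nil_iff [simp]: "letters w = [] \<longleftrightarrow> w = 0"
  by (cases w) (simp add: zero_fword_def)

lemma poly_mapping_sum_single:
  "p = (\<Sum>w\<in>Poly_Mapping.keys p. Poly_Mapping.single w (Poly_Mapping.lookup p w))"
  by (rule poly_mapping_eqI)
    (simp add: lookup_sum lookup_single when_def in_keys_iff)

lemma poly_mapping_add_induct [case_names single add]:
  fixes p :: "'a \<Rightarrow>\<^sub>0 'b::comm_monoid_add"
  assumes single: "\<And>w c. P (Poly_Mapping.single w c)" and add: "\<And>p q. P p \<Longrightarrow> P q \<Longrightarrow> P (p + q)"
  shows "P p"
proof -
  have "P (\<Sum>w\<in>W. Poly_Mapping.single w (Poly_Mapping.lookup p w))" if "finite W" for W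
    \<comment> \<open>A \<open>single\<close> with coefficient 0 is the zero polynomial, which
      settles the empty sum; hence the principle has no separate case for 0.\<close>
    using that single[of undefined 0] by induction (auto intro: single add)
  then show ?thesis
    by (subst poly_mapping_sum_single) simp
qed

lemma gen_mult_single: "gen g * Poly_Mapping.single (FWord xs) c = Poly_Mapping.single (FWord (g # xs)) c"
  by (simp add: gen_def mult_single plus_fword_def)

lemma single_mult_gen: "Poly_Mapping.single (FWord xs) c * gen g = Poly_Mapping.single (FWord (xs @ [g])) c"
  by (simp add: gen_def mult_single plus_fword_def)

lemma scalar_commute:
  "Poly_Mapping.single 0 c * Poly_Mapping.single w 1 = Poly_Mapping.single w 1 * Poly_Mapping.single 0 (c :: 'r::ring_1)"
  by (simp add: mult_single)

text \<open>Serves two purposes: restricting to words over S, which is a ring homomorphism, and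
  extracting from a combination of paths those that end at a given vertex.\<close>

definition restrict_words :: "('g fword \<Rightarrow> bool) \<Rightarrow> ('g fword \<Rightarrow>\<^sub>0 'r::ring_1) \<Rightarrow> 'g fword \<Rightarrow>\<^sub>0 'r" where
  "restrict_words Q p =
     (\<Sum>w\<in>{w \<in> Poly_Mapping.keys p. Q w}. Poly_Mapping.single w (Poly_Mapping.lookup p w))"

lemma lookup_restrict_words:
  "Poly_Mapping.lookup (restrict_words Q p) w = (if Q w then Poly_Mapping.lookup p w else 0)"
  by (auto simp: restrict_words_def lookup_sum lookup_single when_def in_keys_iff)

lemma restrict_words_zero [simp]: "restrict_words Q 0 = 0"
  by (rule poly_mapping_eqI) (simp add: lookup_restrict_words)

lemma restrict_words_add: "restrict_words Q (p + q) = restrict_words Q p + restrict_words Q q"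
  by (rule poly_mapping_eqI) (simp add: lookup_restrict_words lookup_add)

lemma restrict_words_diff: "restrict_words Q (p - q) = restrict_words Q p - restrict_words Q q"
  by (rule poly_mapping_eqI) (simp add: lookup_restrict_words lookup_minus)

lemma restrict_words_single:
  "restrict_words Q (Poly_Mapping.single w c) = (if Q w then Poly_Mapping.single w c else 0)"
  by (rule poly_mapping_eqI) (auto simp: lookup_restrict_words lookup_single when_def)

lemma keys_restrict_words: "Poly_Mapping.keys (restrict_words Q p) = {w \<in> Poly_Mapping.keys p. Q w}"
  by (auto simp: in_keys_iff lookup_restrict_words split: if_splits)

lemma restrict_words_ident: "(\<And>w. w \<in> Poly_Mapping.keys p \<Longrightarrow> Q w) \<Longrightarrow> restrict_words Q p = p"
  by (rule poly_mapping_eqI) (auto simp: lookup_restrict_words in_keys_iff)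

abbreviation restrict_letters :: "'g set \<Rightarrow> ('g fword \<Rightarrow>\<^sub>0 'r::ring_1) \<Rightarrow> 'g fword \<Rightarrow>\<^sub>0 'r" where
  "restrict_letters S \<equiv> restrict_words (\<lambda>w. set (letters w) \<subseteq> S)"

text \<open>A concatenation has all its letters in S exactly when both factors do, so dropping the
  other words respects products.\<close>

lemma restrict_letters_mult: "restrict_letters S (p * q) = restrict_letters S p * restrict_letters S q"
proof (induction p rule: poly_mapping_add_induct)
  case (single u c)
  show ?case
    by (induction q rule: poly_mapping_add_induct)
      (auto simp: mult_single restrict_words_single restrict_words_add distrib_left)
qed (simp add: restrict_words_add distrib_right)

lemma free_algebra_simps [simp]:
  "p \<otimes>\<^bsub>free_algebra S\<^esub> q = p * q" "p \<oplus>\<^bsub>free_algebra S\<^esub> q = p + q" "\<zero>\<^bsub>free_algebra S\<^esub> = 0"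
  by (simp_all add: free_algebra_def)

lemma mem_free_algebra:
  "p \<in> carrier (free_algebra S) \<longleftrightarrow> (\<forall>w\<in>Poly_Mapping.keys p. w \<noteq> 0 \<and> set (letters w) \<subseteq> S)"
  by (simp add: free_algebra_def)

lemma free_algebra_add:
  "p \<in> carrier (free_algebra S) \<Longrightarrow> q \<in> carrier (free_algebra S) \<Longrightarrow> p + q \<in> carrier (free_algebra S)"
  using keys_add[of p q] by (auto simp: mem_free_algebra)

lemma free_algebra_uminus:
  "p \<in> carrier (free_algebra S) \<Longrightarrow> - p \<in> carrier (free_algebra S)"
  by (auto simp: mem_free_algebra in_keys_iff)

lemma free_algebra_diff:
  "p \<in> carrier (free_algebra S) \<Longrightarrow> q \<in> carrier (free_algebra S) \<Longrightarrow> p - q \<in> carrier (free_algebra S)"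
  using free_algebra_add[of p S "- q"] free_algebra_uminus[of q S] by simp

lemma free_algebra_mult:
  assumes "p \<in> carrier (free_algebra S)" "q \<in> carrier (free_algebra S)"
  shows "p * q \<in> carrier (free_algebra S)"
proof -
  have "u + v \<noteq> 0" if "u \<noteq> 0" for u v :: "'a fword"
    using that by (metis append_is_Nil_conv letters_eq_Nil_iff letters_plus)
  moreover have "\<exists>u v. w = u + v \<and> u \<in> Poly_Mapping.keys p \<and> v \<in> Poly_Mapping.keys q"
    if "w \<in> Poly_Mapping.keys (p * q)" for w
    using keys_mult[of p q] that by blast
  ultimately have "w \<noteq> 0 \<and> set (letters w) \<subseteq> S" if "w \<in> Poly_Mapping.keys (p * q)" for w
    using that assms unfolding mem_free_algebra by (metis letters_plus set_append Un_subset_iff)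
  then show ?thesis
    by (simp add: mem_free_algebra)
qed

lemma free_algebra_scalar_mult:
  assumes "p \<in> carrier (free_algebra S)"
  shows "Poly_Mapping.single 0 c * p \<in> carrier (free_algebra S)"
    and "p * Poly_Mapping.single 0 c \<in> carrier (free_algebra S)"
  using assms keys_mult[of "Poly_Mapping.single 0 c" p] keys_mult[of p "Poly_Mapping.single 0 c"]
  by (auto simp: mem_free_algebra split: if_splits)

lemma free_algebra_single:
  "w \<noteq> 0 \<Longrightarrow> set (letters w) \<subseteq> S \<Longrightarrow> Poly_Mapping.single w c \<in> carrier (free_algebra S)"
  by (simp add: mem_free_algebra)

lemma free_algebra_gen: "g \<in> S \<Longrightarrow> gen g \<in> carrier (free_algebra S)"
  by (simp add: gen_def free_algebra_single zero_fword_def)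

lemma free_algebra_sum:
  "(\<And>i. i \<in> I \<Longrightarrow> p i \<in> carrier (free_algebra S)) \<Longrightarrow> sum p I \<in> carrier (free_algebra S)"
  by (induction I rule: infinite_finite_induct) (auto intro: free_algebra_add simp: mem_free_algebra[of 0])

lemma restrict_letters_free_algebra: "p \<in> carrier (free_algebra S) \<Longrightarrow> restrict_letters S p = p"
  by (rule restrict_words_ident) (simp add: mem_free_algebra)

lemma restrict_letters_split:
  obtains c q where "q \<in> carrier (free_algebra S)" "restrict_letters S p = Poly_Mapping.single 0 c + q"
proof
  \<comment> \<open>The coefficient of the empty word is the only obstruction to membership in the
    algebra without identity.\<close>
  let ?c = "Poly_Mapping.lookup p 0"
  show "restrict_letters S p - Poly_Mapping.single 0 ?c \<in> carrier (free_algebra S)"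
    by (auto simp: mem_free_algebra in_keys_iff lookup_minus lookup_single lookup_restrict_words when_def
        split: if_splits)
qed simp

lemma nonunital_ring_free_algebra:
  fixes S :: "'a set"
  shows "nonunital_ring (free_algebra S :: ('a fword \<Rightarrow>\<^sub>0 'b::ring_1) ring)"
proof -
  have "abelian_group (free_algebra S :: ('a fword \<Rightarrow>\<^sub>0 'b) ring)"
  proof (rule abelian_groupI)
    show "\<exists>q\<in>carrier (free_algebra S). q \<oplus>\<^bsub>free_algebra S\<^esub> p = \<zero>\<^bsub>free_algebra S\<^esub>"
      if "p \<in> carrier (free_algebra S)" for p :: "'a fword \<Rightarrow>\<^sub>0 'b"
      using free_algebra_uminus[OF that] by force
  qed (auto intro: free_algebra_add simp: add_ac mem_free_algebra[of 0])
  then show ?thesis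
    by (intro nonunital_ring.intro nonunital_ring_axioms.intro)
      (auto intro: free_algebra_mult simp: mult.assoc distrib_left distrib_right)
qed

lemma a_inv_free_algebra:
  assumes "p \<in> carrier (free_algebra S)"
  shows "\<ominus>\<^bsub>free_algebra S\<^esub> p = - p"
proof -
  interpret nonunital_ring "free_algebra S" by (rule nonunital_ring_free_algebra)
  show ?thesis
    by (rule minus_equality) (use assms free_algebra_uminus in auto)
qed

section \<open>The scalar-closed ideal generated by a set of relations\<close>

definition scalar_closed :: "('g fword \<Rightarrow>\<^sub>0 'r::ring_1) set \<Rightarrow> bool" where
  "scalar_closed I \<longleftrightarrow>
     (\<forall>p\<in>I. \<forall>r. Poly_Mapping.single 0 r * p \<in> I \<and> p * Poly_Mapping.single 0 r \<in> I)"

context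
  fixes S :: "'g set" and P :: "('g fword \<Rightarrow>\<^sub>0 'r::ring_1) set"
  assumes P: "P \<subseteq> carrier (free_algebra S)"
begin

interpretation F: nonunital_ring "free_algebra S :: ('g fword \<Rightarrow>\<^sub>0 'r) ring"
  by (rule nonunital_ring_free_algebra)

lemma algebra_ideal_minimal:
  assumes "two_sided_ideal I (free_algebra S)" "scalar_closed I" "P \<subseteq> I"
  shows "algebra_ideal S P \<subseteq> I"
  using assms unfolding algebra_ideal_def scalar_closed_def by blast

lemma relations_subset_algebra_ideal: "P \<subseteq> algebra_ideal S P"
  unfolding algebra_ideal_def by blast

lemma algebra_ideal_subset: "algebra_ideal S P \<subseteq> carrier (free_algebra S)"
proof (rule algebra_ideal_minimal)
  show "two_sided_ideal (carrier (free_algebra S)) (free_algebra S :: ('g fword \<Rightarrow>\<^sub>0 'r) ring)"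
    by (rule F.two_sided_idealI) (auto intro: free_algebra_add free_algebra_mult simp: mem_free_algebra[of 0])
  show "scalar_closed (carrier (free_algebra S :: ('g fword \<Rightarrow>\<^sub>0 'r) ring))"
    by (auto simp: scalar_closed_def intro: free_algebra_scalar_mult)
qed (rule P)

lemma two_sided_ideal_algebra_ideal: "two_sided_ideal (algebra_ideal S P) (free_algebra S)"
  and scalar_closed_algebra_ideal: "scalar_closed (algebra_ideal S P)"
proof -
  have sub: "p \<in> carrier (free_algebra S)" if "p \<in> algebra_ideal S P" for p
    using algebra_ideal_subset that by blast
  \<comment> \<open>Each ideal in the defining intersection contains the whole intersection, so a
    closure property may be proved in one such ideal at a time.\<close>
  have closure: "f \<in> algebra_ideal S P"
    if "\<And>I. \<lbrakk>two_sided_ideal I (free_algebra S); scalar_closed I; algebra_ideal S P \<subseteq> I\<rbrakk> \<Longrightarrow> f \<in> I" for f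
  proof -
    have "f \<in> I" if I: "two_sided_ideal I (free_algebra S)" "scalar_closed I" "P \<subseteq> I" for I
      using I algebra_ideal_minimal[OF I] \<open>\<And>I. _ \<Longrightarrow> _ \<Longrightarrow> _ \<Longrightarrow> f \<in> I\<close>[of I] by blast
    then show ?thesis
      unfolding algebra_ideal_def scalar_closed_def by blast
  qed
  have ideal: "additive_subgroup I (free_algebra S)"
    "a \<in> I \<Longrightarrow> x \<in> carrier (free_algebra S) \<Longrightarrow> x * a \<in> I"
    "a \<in> I \<Longrightarrow> x \<in> carrier (free_algebra S) \<Longrightarrow> a * x \<in> I"
    if "two_sided_ideal I (free_algebra S)" for I and a x :: "'g fword \<Rightarrow>\<^sub>0 'r"
    using that unfolding two_sided_ideal_def by auto
  show "two_sided_ideal (algebra_ideal S P) (free_algebra S)"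
  proof (rule F.two_sided_idealI)
    show "\<zero>\<^bsub>free_algebra S\<^esub> \<in> algebra_ideal S P"
      by (rule closure, rule additive_subgroup.zero_closed, rule ideal)
    show "a \<oplus>\<^bsub>free_algebra S\<^esub> b \<in> algebra_ideal S P"
      if "a \<in> algebra_ideal S P" "b \<in> algebra_ideal S P" for a b
      by (rule closure, rule additive_subgroup.a_closed, rule ideal) (use that in auto)
    show "\<ominus>\<^bsub>free_algebra S\<^esub> a \<in> algebra_ideal S P" if a: "a \<in> algebra_ideal S P" for a
    proof (rule closure)
      fix I assume I: "two_sided_ideal I (free_algebra S)" "scalar_closed I" "algebra_ideal S P \<subseteq> I"
      then have "Poly_Mapping.single 0 (- 1) * a \<in> I"
        using a by (auto simp: scalar_closed_def)
      moreover have "Poly_Mapping.single 0 (- 1 :: 'r) * a = - a"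
        by (simp add: single_uminus)
      ultimately show "\<ominus>\<^bsub>free_algebra S\<^esub> a \<in> I"
        using sub[OF a] by (simp add: a_inv_free_algebra)
    qed
    show "x \<otimes>\<^bsub>free_algebra S\<^esub> a \<in> algebra_ideal S P"
      if "a \<in> algebra_ideal S P" "x \<in> carrier (free_algebra S)" for a x
      using that ideal(2) by (intro closure) auto
    show "a \<otimes>\<^bsub>free_algebra S\<^esub> x \<in> algebra_ideal S P"
      if "a \<in> algebra_ideal S P" "x \<in> carrier (free_algebra S)" for a x
      using that ideal(3) by (intro closure) auto
  qed (rule algebra_ideal_subset)
  show "scalar_closed (algebra_ideal S P)"
    unfolding scalar_closed_def by (intro ballI allI conjI closure) (auto simp: scalar_closed_def)
qed

text \<open>The multiplier is an arbitrary polynomial after restriction to S. Its constant term is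
  absorbed by closure under scalars and the rest by the ideal property.\<close>

lemma algebra_ideal_closed:
  "0 \<in> algebra_ideal S P"
  "p \<in> algebra_ideal S P \<Longrightarrow> q \<in> algebra_ideal S P \<Longrightarrow> p + q \<in> algebra_ideal S P"
  "p \<in> algebra_ideal S P \<Longrightarrow> q \<in> algebra_ideal S P \<Longrightarrow> p - q \<in> algebra_ideal S P"
  "p \<in> algebra_ideal S P \<Longrightarrow> restrict_letters S q * p \<in> algebra_ideal S P"
  "p \<in> algebra_ideal S P \<Longrightarrow> p * restrict_letters S q \<in> algebra_ideal S P"
proof -
  let ?J = "algebra_ideal S P"
  have J: "additive_subgroup ?J (free_algebra S)"
    "p \<in> ?J \<Longrightarrow> x \<in> carrier (free_algebra S) \<Longrightarrow> x * p \<in> ?J"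
    "p \<in> ?J \<Longrightarrow> x \<in> carrier (free_algebra S) \<Longrightarrow> p * x \<in> ?J" for p x
    using two_sided_ideal_algebra_ideal unfolding two_sided_ideal_def by auto
  have scalar: "Poly_Mapping.single 0 c * p \<in> ?J" "p * Poly_Mapping.single 0 c \<in> ?J" if "p \<in> ?J" for p c
    using scalar_closed_algebra_ideal that by (auto simp: scalar_closed_def)
  show zero: "0 \<in> ?J"
    using additive_subgroup.zero_closed[OF J(1)] by simp
  show add: "p + q \<in> ?J" if "p \<in> ?J" "q \<in> ?J" for p q
    using additive_subgroup.a_closed[OF J(1)] that by simp
  have "Poly_Mapping.single 0 (- 1 :: 'r) * q = - q" for q
    by (simp add: single_uminus)
  with scalar(1)[of _ "- 1"] add show "p - q \<in> ?J" if "p \<in> ?J" "q \<in> ?J" for p q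
    using that by (metis diff_conv_add_uminus)
  obtain c q' where q': "q' \<in> carrier (free_algebra S)" "restrict_letters S q = Poly_Mapping.single 0 c + q'"
    by (rule restrict_letters_split)
  show "restrict_letters S q * p \<in> ?J" if "p \<in> ?J"
    using that q'(1) unfolding q'(2) distrib_right by (intro add scalar(1) J(2))
  show "p * restrict_letters S q \<in> ?J" if "p \<in> ?J"
    using that q'(1) unfolding q'(2) distrib_left by (intro add scalar(2) J(3))
qed

end

section \<open>Calculating in the Leavitt path algebra\<close>

context wf_digraph
begin

text \<open>The preimage of the relation ideal under the homomorphism that drops foreign letters. It
  is a two-sided ideal of the full unital free algebra, so congruences can be multiplied by any
  polynomial, scalars included, without membership conditions.\<close>

definition null_elements :: "(('a, 'b) generator fword \<Rightarrow>\<^sub>0 'r::ring_1) set" where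
  "null_elements =
     {p. restrict_letters (generators G) p \<in> algebra_ideal (generators G) (leavitt_relations G)}"

definition lpa_eq ::
  "(('a, 'b) generator fword \<Rightarrow>\<^sub>0 'r::ring_1) \<Rightarrow> (('a, 'b) generator fword \<Rightarrow>\<^sub>0 'r) \<Rightarrow> bool" (infix "\<doteq>" 50)
  where "p \<doteq> q \<longleftrightarrow> p - q \<in> null_elements"

lemma leavitt_relations_subset: "leavitt_relations G \<subseteq> carrier (free_algebra (generators G))"
proof -
  have zero: "0 \<in> carrier (free_algebra (generators G))"
    by (simp add: mem_free_algebra)
  have "gen (Vert v) \<in> carrier (free_algebra (generators G))" if "v \<in> verts G" for v
    using that by (intro free_algebra_gen) (simp add: generators_def)
  moreover have "gen (Edge f) \<in> carrier (free_algebra (generators G))"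
    "gen (Ghost f) \<in> carrier (free_algebra (generators G))" if "f \<in> arcs G" for f
    using that by (auto intro!: free_algebra_gen simp: generators_def)
  ultimately show ?thesis
    using zero unfolding leavitt_relations_def
    by (auto intro!: free_algebra_diff free_algebra_mult free_algebra_sum)
qed

lemmas lpa_ideal_closed = algebra_ideal_closed[OF leavitt_relations_subset]

lemma null_elements_closed:
  "0 \<in> null_elements"
  "p \<in> null_elements \<Longrightarrow> q \<in> null_elements \<Longrightarrow> p + q \<in> null_elements"
  "p \<in> null_elements \<Longrightarrow> q \<in> null_elements \<Longrightarrow> p - q \<in> null_elements"
  "p \<in> null_elements \<Longrightarrow> q * p \<in> null_elements"
  "p \<in> null_elements \<Longrightarrow> p * q \<in> null_elements"
  unfolding null_elements_def mem_Collect_eq restrict_words_zero restrict_words_add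
    restrict_words_diff restrict_letters_mult
  by (fact lpa_ideal_closed)+

lemma null_elements_iff:
  "p \<in> carrier (free_algebra (generators G)) \<Longrightarrow>
    p \<in> null_elements \<longleftrightarrow> p \<in> algebra_ideal (generators G) (leavitt_relations G)"
  by (simp add: null_elements_def restrict_letters_free_algebra)

lemma lpa_eq_zero_iff: "p \<doteq> 0 \<longleftrightarrow> p \<in> null_elements"
  by (simp add: lpa_eq_def)

lemma lpa_eq_refl [simp, intro]: "p \<doteq> p"
  by (simp add: lpa_eq_def null_elements_closed)

lemma lpa_eq_sym: "p \<doteq> q \<Longrightarrow> q \<doteq> p"
  unfolding lpa_eq_def using null_elements_closed(1) null_elements_closed(3)[of 0 "p - q"] by simp

lemma lpa_eq_trans [trans]: "p \<doteq> q \<Longrightarrow> q \<doteq> r \<Longrightarrow> p \<doteq> r"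
  unfolding lpa_eq_def using null_elements_closed(2)[of "p - q" "q - r"] by simp

lemma lpa_eq_add: "p \<doteq> q \<Longrightarrow> p' \<doteq> q' \<Longrightarrow> p + p' \<doteq> q + q'"
  unfolding lpa_eq_def using null_elements_closed(2)[of "p - q" "p' - q'"] by (simp add: algebra_simps)

lemma lpa_eq_lmult: "p \<doteq> q \<Longrightarrow> r * p \<doteq> r * q"
  unfolding lpa_eq_def using null_elements_closed(4)[of "p - q" r] by (simp add: algebra_simps)

lemma lpa_eq_rmult: "p \<doteq> q \<Longrightarrow> p * r \<doteq> q * r"
  unfolding lpa_eq_def using null_elements_closed(5)[of "p - q" r] by (simp add: algebra_simps)

lemma lpa_eq_sum: "(\<And>i. i \<in> I \<Longrightarrow> p i \<doteq> q i) \<Longrightarrow> sum p I \<doteq> sum q I"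
  by (induction I rule: infinite_finite_induct) (auto intro: lpa_eq_add)

lemma lpa_relation: "p - q \<in> leavitt_relations G \<Longrightarrow> p \<doteq> q"
  using relations_subset_algebra_ideal[OF leavitt_relations_subset]
    null_elements_iff[OF subsetD[OF leavitt_relations_subset]]
  unfolding lpa_eq_def by blast

lemma vert_vert: "v \<in> verts G \<Longrightarrow> w \<in> verts G \<Longrightarrow> gen (Vert v) * gen (Vert w) \<doteq> (if v = w then gen (Vert v) else 0)"
  by (rule lpa_relation) (auto simp: leavitt_relations_def)

lemma tail_edge: "f \<in> arcs G \<Longrightarrow> gen (Vert (tail G f)) * gen (Edge f) \<doteq> gen (Edge f)"
  by (rule lpa_relation) (auto simp: leavitt_relations_def)

lemma edge_head: "f \<in> arcs G \<Longrightarrow> gen (Edge f) * gen (Vert (head G f)) \<doteq> gen (Edge f)"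
  by (rule lpa_relation) (auto simp: leavitt_relations_def)

lemma head_ghost: "f \<in> arcs G \<Longrightarrow> gen (Vert (head G f)) * gen (Ghost f) \<doteq> gen (Ghost f)"
  by (rule lpa_relation) (auto simp: leavitt_relations_def)

lemma ghost_tail: "f \<in> arcs G \<Longrightarrow> gen (Ghost f) * gen (Vert (tail G f)) \<doteq> gen (Ghost f)"
  by (rule lpa_relation) (auto simp: leavitt_relations_def)

lemma ghost_edge:
  "f \<in> arcs G \<Longrightarrow> f' \<in> arcs G \<Longrightarrow> gen (Ghost f) * gen (Edge f') \<doteq> (if f = f' then gen (Vert (head G f)) else 0)"
  by (rule lpa_relation) (auto simp: leavitt_relations_def)

lemma sum_edge_ghost:
  "v \<in> verts G \<Longrightarrow> finite (out_arcs G v) \<Longrightarrow> out_arcs G v \<noteq> {} \<Longrightarrow>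
    (\<Sum>f\<in>out_arcs G v. gen (Edge f) * gen (Ghost f)) \<doteq> gen (Vert v)"
  by (rule lpa_relation) (unfold leavitt_relations_def, rule UnI2, blast)

end

section \<open>A representation\<close>

fun letter_degree :: "('v, 'e) generator \<Rightarrow> int" where
  "letter_degree (Vert v) = 0"
| "letter_degree (Edge f) = 1"
| "letter_degree (Ghost f) = - 1"

definition word_degree :: "('v, 'e) generator fword \<Rightarrow> int" where
  "word_degree w = sum_list (map letter_degree (letters w))"

lemma word_degree_plus: "word_degree (u + v) = word_degree u + word_degree v"
  by (simp add: word_degree_def)

text \<open>A condition on the words of the polynomial itself and not on its class. Remainders are
  kept unreduced, so that their degrees can be read off.\<close>

definition positive_part :: "(('v, 'e) generator fword \<Rightarrow>\<^sub>0 'r::ring_1) set" where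
  "positive_part = {p. \<forall>w\<in>Poly_Mapping.keys p. 0 < word_degree w}"

definition "option_value \<phi> x = (case x of None \<Rightarrow> 0 | Some z \<Rightarrow> \<phi> z)"

lemma option_value_simps [simp]: "option_value \<phi> None = 0" "option_value \<phi> (Some z) = \<phi> z"
  by (simp_all add: option_value_def)

text \<open>The points with first coordinate \<open>v\<close> form a copy of one set \<open>Y\<close> for every vertex \<open>v\<close>. Each arc \<open>f\<close> maps the
  copy at its head injectively into the copy at its tail; the images of the arcs leaving \<open>v\<close> are
  disjoint, and they cover the copy at \<open>v\<close> if these arcs are finite in number. If there are \<open>n\<close> of
  them, this is the bijection \<open>(m, i) \<mapsto> m * n + i\<close> on the third coordinate; otherwise the arc is put in
  front of the list. Functions on points are pulled back along the partial maps, hence a ghost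
  letter moves points along its arc and an edge letter moves them backwards.\<close>

type_synonym ('v, 'e) point = "'v \<times> 'e list \<times> nat \<times> int"

context wf_digraph
begin

text \<open>Numbers the arcs with a common tail. If there are finitely many, this is a bijection
  onto the numbers below their cardinality, the remainders used in \<open>move\<close>.\<close>

definition arc_index :: "'b \<Rightarrow> nat" where
  "arc_index f = to_nat_on (out_arcs G (tail G f)) f"

fun move :: "('a, 'b) generator \<Rightarrow> ('a, 'b) point \<Rightarrow> ('a, 'b) point option" where
  "move (Vert v) (u, l, m, k) = (if u = v then Some (u, l, m, k) else None)"
| "move (Ghost f) (u, l, m, k) =
    (if u \<noteq> head G f then None
     else if finite (out_arcs G (tail G f))
     then Some (tail G f, l, m * card (out_arcs G (tail G f)) + arc_index f, k + 1)
     else Some (tail G f, f # l, m, k + 1))"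
| "move (Edge f) (u, l, m, k) =
    (if u \<noteq> tail G f then None
     else if finite (out_arcs G (tail G f))
     then (if m mod card (out_arcs G u) = arc_index f
           then Some (head G f, l, m div card (out_arcs G u), k - 1) else None)
     else (if l \<noteq> [] \<and> hd l = f then Some (head G f, tl l, m, k - 1) else None))"

fun moves :: "('a, 'b) generator list \<Rightarrow> ('a, 'b) point \<Rightarrow> ('a, 'b) point option" where
  "moves [] y = Some y"
| "moves (g # gs) y = Option.bind (move g y) (moves gs)"

lemma moves_append: "moves (gs @ hs) y = Option.bind (moves gs y) (moves hs)"
  by (induction gs arbitrary: y) (auto split: bind_split)

text \<open>Words act by pullback and coefficients by left multiplication of the values. Pullback
  reverses composition, but \<open>moves\<close> lets the first letter move the point first; the two
  reversals cancel, so \<open>act_mult\<close> keeps the order of the factors. Since values are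
  multiplied on the left only, R may be non-commutative.\<close>

definition act ::
  "(('a, 'b) generator fword \<Rightarrow>\<^sub>0 'r::ring_1) \<Rightarrow> (('a, 'b) point \<Rightarrow> 'r) \<Rightarrow> ('a, 'b) point \<Rightarrow> 'r" where
  "act p \<phi> y =
     (\<Sum>w\<in>Poly_Mapping.keys p. Poly_Mapping.lookup p w * option_value \<phi> (moves (letters w) y))"

lemma act_superset:
  assumes "finite W" "Poly_Mapping.keys p \<subseteq> W"
  shows "act p \<phi> y = (\<Sum>w\<in>W. Poly_Mapping.lookup p w * option_value \<phi> (moves (letters w) y))"
  unfolding act_def by (rule sum.mono_neutral_left) (use assms in \<open>auto simp: in_keys_iff\<close>)

lemma act_add: "act (p + q) \<phi> y = act p \<phi> y + act q \<phi> y"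
proof -
  let ?W = "Poly_Mapping.keys p \<union> Poly_Mapping.keys q"
  show ?thesis
    using keys_add[of p q]
    by (simp add: act_superset[of ?W] lookup_add distrib_right sum.distrib)
qed

lemma act_single: "act (Poly_Mapping.single w c) \<phi> y = c * option_value \<phi> (moves (letters w) y)"
  by (simp add: act_def)

lemma act_zero [simp]: "act 0 \<phi> y = 0"
  by (simp add: act_def)

lemma act_diff: "act (p - q) \<phi> y = act p \<phi> y - act q \<phi> y"
  using act_add[of "p - q" q \<phi> y] by simp

lemma act_sum: "act (sum p I) \<phi> y = (\<Sum>i\<in>I. act (p i) \<phi> y)"
  by (induction I rule: infinite_finite_induct) (auto simp: act_add)

lemma act_fun_add: "act p (\<lambda>y. \<phi> y + \<psi> y) y = act p \<phi> y + act p \<psi> y"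
  by (induction p rule: poly_mapping_add_induct)
    (auto simp: act_single act_add option_value_def distrib_left split: option.split)

lemma act_mult: "act (p * q) \<phi> y = act p (act q \<phi>) y"
proof (induction p rule: poly_mapping_add_induct)
  case (single u c)
  show ?case
  proof (induction q rule: poly_mapping_add_induct)
    case (single v d)
    show ?case
      by (cases "moves (letters u) y") (auto simp: mult_single act_single moves_append mult.assoc)
  next
    case (add p q)
    have "act (p + q) \<phi> = (\<lambda>y. act p \<phi> y + act q \<phi> y)"
      by (rule ext) (rule act_add)
    with add show ?case
      by (simp add: distrib_left act_add act_fun_add)
  qed
qed (simp add: distrib_right act_add)

lemma act_gen: "act (gen g) \<phi> y = option_value \<phi> (move g y)"
  by (cases "move g y") (simp_all add: gen_def act_single)

lemma arc_index_less:
  assumes "f \<in> arcs G" "finite (out_arcs G (tail G f))"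
  shows "arc_index f < card (out_arcs G (tail G f))"
  using bij_betwE[OF to_nat_on_finite[OF assms(2)]] assms(1) by (auto simp: arc_index_def)

text \<open>This and the following lemmas up to \<open>move_ghost_edge\<close> are the relations for
  products of two letters, as identities of partial maps.\<close>

lemma move_move_vert: "Option.bind (move (Vert v) y) (move (Vert w)) = (if v = w then move (Vert v) y else None)"
  by (cases y) auto

lemma move_tail_edge: "Option.bind (move (Vert (tail G f)) y) (move (Edge f)) = move (Edge f) y"
  by (cases y) auto

lemma move_edge_head: "Option.bind (move (Edge f) y) (move (Vert (head G f))) = move (Edge f) y"
  by (cases y) auto

lemma move_head_ghost: "Option.bind (move (Vert (head G f)) y) (move (Ghost f)) = move (Ghost f) y"
  by (cases y) auto

lemma move_ghost_tail: "Option.bind (move (Ghost f) y) (move (Vert (tail G f))) = move (Ghost f) y"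
  by (cases y) auto

lemma move_ghost_edge:
  assumes "f \<in> arcs G" "f' \<in> arcs G"
  shows "Option.bind (move (Ghost f) y) (move (Edge f')) = (if f = f' then move (Vert (head G f)) y else None)"
proof -
  obtain u l m k where y: "y = (u, l, m, k)" by (cases y) auto
  show ?thesis
  proof (cases "finite (out_arcs G (tail G f))")
    case True
    \<comment> \<open>The index is below the number of arcs, so quotient and remainder of
      \<open>m * n + i\<close> give back m and the arc.\<close>
    have less: "arc_index f < card (out_arcs G (tail G f))"
      using assms True by (simp add: arc_index_less)
    then have div: "(m * card (out_arcs G (tail G f)) + arc_index f) div card (out_arcs G (tail G f)) = m"
      by (subst div_mult_self3) auto
    have "arc_index f \<noteq> arc_index f'" if "f \<noteq> f'" "tail G f = tail G f'"
      using that assms bij_betw_imp_inj_on[OF to_nat_on_finite[OF True]]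
      by (metis arc_index_def in_out_arcs_conv inj_onD)
    then show ?thesis
      using div less True unfolding y by (cases "f = f'"; cases "tail G f = tail G f'") simp_all
  next
    case False
    then show ?thesis
      unfolding y by (cases "f = f'"; cases "tail G f = tail G f'") simp_all
  qed
qed

text \<open>Exactly one arc leaving v has the index m mod n. Moving backwards along it and forwards
  again returns to m = (m div n) * n + m mod n; along every other arc the backward move is
  undefined.\<close>

lemma sum_move_edge_ghost:
  assumes "finite (out_arcs G v)" "out_arcs G v \<noteq> {}"
  shows "(\<Sum>f\<in>out_arcs G v. option_value \<phi> (Option.bind (move (Edge f) y) (move (Ghost f))))
    = option_value \<phi> (move (Vert v) y)"
proof -
  obtain u l m k where y: "y = (u, l, m, k)" by (cases y) auto
  show ?thesis
  proof (cases "u = v")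
    case True
    let ?n = "card (out_arcs G v)"
    have "m mod ?n < ?n"
      using assms by (simp add: card_gt_0_iff)
    then obtain f where f: "f \<in> out_arcs G v" "to_nat_on (out_arcs G v) f = m mod ?n"
      using bij_betw_imp_surj_on[OF to_nat_on_finite[OF assms(1)]] by (metis imageE lessThan_iff)
    have "option_value \<phi> (Option.bind (move (Edge g) y) (move (Ghost g))) = (if g = f then \<phi> y else 0)"
      if g: "g \<in> out_arcs G v" for g
    proof (cases "g = f")
      case True
      then show ?thesis
        using f assms \<open>u = v\<close> by (simp add: y arc_index_def)
    next
      case False
      then have "to_nat_on (out_arcs G v) g \<noteq> m mod ?n"
        using f g bij_betw_imp_inj_on[OF to_nat_on_finite[OF assms(1)]] by (metis inj_onD)
      then show ?thesis
        using g assms \<open>u = v\<close> False by (auto simp: y arc_index_def)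
    qed
    then show ?thesis
      using f assms \<open>u = v\<close> by (simp add: y)
  qed (auto simp: y intro!: sum.neutral)
qed

lemma act_relation:
  assumes "p \<in> leavitt_relations G"
  shows "act p \<phi> y = 0"
proof -
  have act_gen_gen: "act (gen g * gen h) \<phi> y = option_value \<phi> (Option.bind (move g y) (move h))" for g h
    by (cases "move g y") (auto simp: act_mult act_gen)
  have "(\<Sum>f\<in>out_arcs G (tail G e). option_value \<phi> (Option.bind (move (Edge f) y) (move (Ghost f))))
      = option_value \<phi> (move (Vert (tail G e)) y)" if "finite (out_arcs G (tail G e))" "e \<in> arcs G" for e
    using that by (intro sum_move_edge_ghost) auto
  then show ?thesis
    using assms unfolding leavitt_relations_def
    by (auto simp: act_diff act_sum act_gen_gen act_gen move_move_vert move_tail_edge move_edge_head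
        move_head_ghost move_ghost_tail move_ghost_edge)
qed

text \<open>The elements of the free algebra that annihilate all functions form a scalar-closed
  ideal containing the relations, hence containing the relation ideal. The restriction is essential:
  letters outside the graph are null elements by definition, but may act nontrivially.\<close>

lemma act_null_element:
  fixes p :: "('a, 'b) generator fword \<Rightarrow>\<^sub>0 'r::ring_1"
  assumes "p \<in> null_elements"
  shows "act (restrict_letters (generators G) p) \<phi> y = 0"
proof -
  let ?F = "free_algebra (generators G) :: (('a, 'b) generator fword \<Rightarrow>\<^sub>0 'r) ring"
  \<comment> \<open>Quantifying over all functions is what makes K closed under multiplication on
    the right.\<close>
  define K where "K = {p \<in> carrier ?F. \<forall>\<phi> y. act p \<phi> y = 0}"
  interpret F: nonunital_ring ?F
    by (rule nonunital_ring_free_algebra)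
  have "two_sided_ideal K ?F"
  proof (rule F.two_sided_idealI)
    show "\<ominus>\<^bsub>?F\<^esub> a \<in> K" if "a \<in> K" for a
      using that act_diff[of 0 a] by (auto simp: K_def a_inv_free_algebra free_algebra_uminus)
    show "x \<otimes>\<^bsub>?F\<^esub> a \<in> K" if "a \<in> K" "x \<in> carrier ?F" for a x
    proof -
      have "act a \<phi> = (\<lambda>_. 0)" for \<phi>
        using that by (auto simp: K_def)
      moreover have "act x (\<lambda>_. 0) y = 0" for y
        by (auto simp: act_def option_value_def intro!: sum.neutral split: option.split)
      ultimately show ?thesis
        using that by (simp add: K_def free_algebra_mult act_mult)
    qed
  qed (auto simp: K_def free_algebra_add free_algebra_mult act_add act_mult mem_free_algebra[of 0])
  moreover have "scalar_closed K"
    by (auto simp: scalar_closed_def K_def free_algebra_scalar_mult act_mult act_single)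
  moreover have "leavitt_relations G \<subseteq> K"
    using leavitt_relations_subset by (auto simp: K_def act_relation)
  ultimately have "algebra_ideal (generators G) (leavitt_relations G) \<subseteq> K"
    using algebra_ideal_minimal[OF leavitt_relations_subset] by blast
  then show ?thesis
    using assms unfolding null_elements_def K_def by blast
qed

lemma moves_degree:
  "moves gs (u, l, m, k) = Some (u', l', m', k') \<Longrightarrow> k' = k - sum_list (map letter_degree gs)"
proof (induction gs arbitrary: u l m k)
  case (Cons g gs)
  show ?case
    using Cons.prems by (cases g) (auto split: if_splits dest: Cons.IH)
qed simp

text \<open>The last coordinate of a point makes the representation graded, so that words of positive
  degree do not contribute to diagonal values.\<close>

lemma vert_plus_positive_nonzero:
  assumes v: "v \<in> verts G" and z: "z \<in> positive_part" and "c \<noteq> 0"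
  shows "\<not> Poly_Mapping.single 0 c * gen (Vert v) + z \<doteq> 0"
proof
  assume "Poly_Mapping.single 0 c * gen (Vert v) + z \<doteq> 0"
  then have null: "Poly_Mapping.single 0 c * gen (Vert v) + z \<in> null_elements"
    by (simp add: lpa_eq_zero_iff)
  \<comment> \<open>The value at y of the image of the indicator function of y is a diagonal
    coefficient: the vertex contributes c, and a word of positive degree changes the last
    coordinate.\<close>
  define y :: "('a, 'b) point" where "y = (v, [], 0, 0)"
  define \<phi> where "\<phi> x = (if x = y then 1 else 0 :: 'c)" for x
  let ?z = "restrict_letters (generators G) z"
  have restrict: "restrict_letters (generators G) (Poly_Mapping.single 0 c * gen (Vert v) + z)
      = Poly_Mapping.single (FWord [Vert v]) c + ?z"
    using v by (simp add: restrict_words_add gen_def mult_single restrict_words_single generators_def)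
  have "act ?z \<phi> y = 0"
    unfolding act_def
  proof (rule sum.neutral, rule ballI)
    fix w assume "w \<in> Poly_Mapping.keys ?z"
    then have "0 < word_degree w"
      using z by (auto simp: keys_restrict_words positive_part_def)
    then have "moves (letters w) y \<noteq> Some y"
      using moves_degree[of "letters w" v "[]" 0 0 v "[]" 0 0] by (auto simp: word_degree_def y_def)
    then show "Poly_Mapping.lookup ?z w * option_value \<phi> (moves (letters w) y) = 0"
      by (cases "moves (letters w) y") (auto simp: \<phi>_def)
  qed
  then have "c = 0"
    using act_null_element[OF null, of \<phi> y] unfolding restrict
    by (simp add: act_add act_single y_def \<phi>_def)
  with \<open>c \<noteq> 0\<close> show False ..
qed

end

section \<open>Normal forms\<close>

text \<open>Right cancellation in the free monoid. It keeps a polynomial nonzero when an edge is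
  appended to its words, before any relation is applied.\<close>

lemma lookup_mult_single_right:
  fixes p :: "'g fword \<Rightarrow>\<^sub>0 'r::ring_1"
  shows "Poly_Mapping.lookup (p * Poly_Mapping.single v 1) (w + v) = Poly_Mapping.lookup p w"
proof (induction p rule: poly_mapping_add_induct)
  case (single u c)
  have "u + v = w + v \<longleftrightarrow> u = w"
    by (metis append_same_eq fword.expand letters_plus)
  then show ?case
    by (simp add: mult_single lookup_single when_def)
qed (simp add: distrib_right lookup_add)

lemma keys_scalar_mult: "Poly_Mapping.keys (Poly_Mapping.single 0 c * p) \<subseteq> Poly_Mapping.keys p"
  using keys_mult[of "Poly_Mapping.single 0 c" p] by (auto split: if_splits)

context wf_digraph
begin

section \<open>Combinations of paths and their products with vertices and edges\<close>

lemma letter_mult_vert: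
  assumes g: "gen g * gen (Vert u) \<doteq> (gen g :: ('a, 'b) generator fword \<Rightarrow>\<^sub>0 'r::ring_1)"
    and "u \<in> verts G" "v \<in> verts G"
  shows "gen g * gen (Vert v) \<doteq> (if u = v then gen g else (0 :: ('a, 'b) generator fword \<Rightarrow>\<^sub>0 'r))"
proof -
  have "gen g * gen (Vert v) \<doteq> gen g * gen (Vert u) * (gen (Vert v) :: ('a, 'b) generator fword \<Rightarrow>\<^sub>0 'r)"
    by (rule lpa_eq_rmult[OF lpa_eq_sym[OF g]])
  also have "\<dots> = gen g * (gen (Vert u) * gen (Vert v))"
    by (simp add: mult.assoc)
  also have "\<dots> \<doteq> gen g * (if u = v then gen (Vert u) else 0)"
    using assms by (intro lpa_eq_lmult vert_vert)
  also have "\<dots> \<doteq> (if u = v then gen g else 0)"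
    using g by auto
  finally show ?thesis .
qed

lemma edge_vert: "f \<in> arcs G \<Longrightarrow> v \<in> verts G \<Longrightarrow>
    gen (Edge f) * gen (Vert v) \<doteq> (if head G f = v then gen (Edge f) else 0)"
  by (rule letter_mult_vert) (auto intro: edge_head)

lemma ghost_vert: "f \<in> arcs G \<Longrightarrow> v \<in> verts G \<Longrightarrow>
    gen (Ghost f) * gen (Vert v) \<doteq> (if tail G f = v then gen (Ghost f) else 0)"
  by (rule letter_mult_vert) (auto intro: ghost_tail)

text \<open>The leading vertex makes trivial paths nonempty words, and makes start and edge list of
  a path readable from its word.\<close>

definition path_word :: "'a \<Rightarrow> 'b list \<Rightarrow> ('a, 'b) generator fword" where
  "path_word u p = FWord (Vert u # map Edge p)"

definition path_word_to :: "'a \<Rightarrow> ('a, 'b) generator fword \<Rightarrow> bool" where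
  "path_word_to v w \<longleftrightarrow> (\<exists>u p. awalk u p v \<and> w = path_word u p)"

text \<open>Membership is literal, not up to congruence, so that \<open>a \<noteq> 0\<close> is a
  statement about coefficients.\<close>

definition path_span :: "(('a, 'b) generator fword \<Rightarrow>\<^sub>0 'r::ring_1) set" where
  "path_span = {a. \<forall>w\<in>Poly_Mapping.keys a. \<exists>v. path_word_to v w}"

lemma path_word_eq_iff: "path_word u p = path_word v q \<longleftrightarrow> u = v \<and> p = q"
  by (auto simp: path_word_def inj_map_eq_map inj_def)

lemma path_word_to_unique: "path_word_to v w \<Longrightarrow> path_word_to v' w \<Longrightarrow> v = v'"
  by (auto simp: path_word_to_def path_word_eq_iff dest: awlast_if_cas simp: awalk_def)

lemma path_word_mult_vert:
  assumes "path_word_to v w" "v' \<in> verts G"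
  shows "Poly_Mapping.single w c * gen (Vert v') \<doteq> (if v = v' then Poly_Mapping.single w c else 0)"
proof -
  obtain u p where p: "awalk u p v" "w = path_word u p"
    using assms by (auto simp: path_word_to_def)
  \<comment> \<open>Only the last letter matters: it is \<open>Vert v\<close> for a trivial path and
    otherwise an edge with head v.\<close>
  obtain gs g where gs: "w = FWord (gs @ [g])" "gen g * gen (Vert v') \<doteq> (if v = v' then gen g else (0 :: ('a, 'b) generator fword \<Rightarrow>\<^sub>0 'c))"
  proof (cases p rule: rev_cases)
    case Nil
    then show ?thesis
      using p assms vert_vert[of v v'] that[of "[]" "Vert v"]
      by (auto simp: path_word_def awalk_def split: if_splits)
  next
    case (snoc q f)
    then have "f \<in> arcs G" "head G f = v"
      using p by (auto simp: awalk_def)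
    then show ?thesis
      using snoc p assms edge_vert[of f v'] that[of "Vert u # map Edge q" "Edge f"] by (auto simp: path_word_def)
  qed
  have "Poly_Mapping.single w c * gen (Vert v') = Poly_Mapping.single (FWord gs) c * (gen g * gen (Vert v'))"
    unfolding gs mult.assoc[symmetric] by (simp add: single_mult_gen)
  also have "\<dots> \<doteq> Poly_Mapping.single (FWord gs) c * (if v = v' then gen g else 0)"
    by (rule lpa_eq_lmult) (rule gs)
  also have "\<dots> = (if v = v' then Poly_Mapping.single w c else 0)"
    by (simp add: gs single_mult_gen)
  finally show ?thesis .
qed

lemma path_span_mult_vert:
  assumes a: "a \<in> path_span" and v: "v \<in> verts G"
  shows "a * gen (Vert v) \<doteq> restrict_words (path_word_to v) a"
proof -
  have "a * gen (Vert v) = (\<Sum>w\<in>Poly_Mapping.keys a. Poly_Mapping.single w (Poly_Mapping.lookup a w) * gen (Vert v))"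
    by (subst poly_mapping_sum_single[of a]) (simp add: sum_distrib_right)
  also have "\<dots> \<doteq> (\<Sum>w\<in>Poly_Mapping.keys a.
      if path_word_to v w then Poly_Mapping.single w (Poly_Mapping.lookup a w) else 0)"
  proof (rule lpa_eq_sum)
    fix w assume "w \<in> Poly_Mapping.keys a"
    then obtain v' where v': "path_word_to v' w"
      using a by (auto simp: path_span_def)
    then have "path_word_to v w \<longleftrightarrow> v' = v"
      by (auto dest: path_word_to_unique)
    then show "Poly_Mapping.single w (Poly_Mapping.lookup a w) * gen (Vert v)
        \<doteq> (if path_word_to v w then Poly_Mapping.single w (Poly_Mapping.lookup a w) else 0)"
      using path_word_mult_vert[OF v' v, of "Poly_Mapping.lookup a w"] by simp
  qed
  also have "\<dots> = restrict_words (path_word_to v) a"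
    by (simp add: restrict_words_def sum.inter_filter)
  finally show ?thesis .
qed

lemma path_span_restrict_words: "a \<in> path_span \<Longrightarrow> restrict_words Q a \<in> path_span"
  by (auto simp: path_span_def keys_restrict_words)

lemma path_span_zero: "0 \<in> path_span"
  by (simp add: path_span_def)

lemma path_span_add: "a \<in> path_span \<Longrightarrow> b \<in> path_span \<Longrightarrow> a + b \<in> path_span"
  using keys_add[of a b] by (auto simp: path_span_def)

lemma path_span_vert: "v \<in> verts G \<Longrightarrow> Poly_Mapping.single (FWord [Vert v]) c \<in> path_span"
  by (auto simp: path_span_def path_word_to_def path_word_def awalk_def)

lemma path_span_mult_edge:
  assumes a: "\<And>w. w \<in> Poly_Mapping.keys a \<Longrightarrow> path_word_to (tail G f) w" and f: "f \<in> arcs G"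
  shows "a * gen (Edge f) \<in> path_span"
proof -
  have "path_word_to (head G f) (w + FWord [Edge f])" if "path_word_to (tail G f) w" for w
  proof -
    obtain u p where p: "awalk u p (tail G f)" "w = path_word u p"
      using \<open>path_word_to (tail G f) w\<close> by (auto simp: path_word_to_def)
    have "awalk (tail G f) [f] (head G f)"
      using f by (simp add: arc_implies_awalk)
    with p(1) have "awalk u (p @ [f]) (head G f)"
      by (rule awalk_appendI)
    then show ?thesis
      using p unfolding path_word_to_def
      by (intro exI[of _ u] exI[of _ "p @ [f]"]) (simp add: path_word_def plus_fword_def)
  qed
  moreover have "\<exists>w\<in>Poly_Mapping.keys a. w' = w + FWord [Edge f]" if "w' \<in> Poly_Mapping.keys (a * gen (Edge f))" for w'
    using keys_mult[of a "gen (Edge f)"] that by (auto simp: gen_def)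
  ultimately show ?thesis
    using a unfolding path_span_def by blast
qed

text \<open>Writing f as its tail times f first discards the paths that end elsewhere; appending f
  to the remaining ones is injective, whence the last claim.\<close>

lemma path_span_mult_edge_eq:
  assumes a: "a \<in> path_span" and f: "f \<in> arcs G"
  defines "b \<equiv> restrict_words (path_word_to (tail G f)) a * gen (Edge f)"
  shows "b \<in> path_span" "a * gen (Edge f) \<doteq> b"
    "restrict_words (path_word_to (tail G f)) a \<noteq> 0 \<Longrightarrow> b \<noteq> 0"
proof -
  show "b \<in> path_span"
    unfolding b_def by (rule path_span_mult_edge) (auto simp: keys_restrict_words f)
  have "a * gen (Edge f) \<doteq> a * (gen (Vert (tail G f)) * gen (Edge f))"
    by (intro lpa_eq_lmult lpa_eq_sym[OF tail_edge] f)
  also have "\<dots> = a * gen (Vert (tail G f)) * gen (Edge f)"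
    by (simp add: mult.assoc)
  also have "\<dots> \<doteq> b"
    unfolding b_def using a f by (intro lpa_eq_rmult path_span_mult_vert) auto
  finally show "a * gen (Edge f) \<doteq> b" .
  show "b \<noteq> 0" if nz: "restrict_words (path_word_to (tail G f)) a \<noteq> 0"
  proof -
    obtain w where "Poly_Mapping.lookup (restrict_words (path_word_to (tail G f)) a) w \<noteq> 0"
      using nz by (metis lookup_zero poly_mapping_eqI)
    then have "Poly_Mapping.lookup b (w + FWord [Edge f]) \<noteq> 0"
      by (simp add: b_def gen_def lookup_mult_single_right)
    then show ?thesis by auto
  qed
qed

text \<open>Elements that are, modulo the relations, combinations of words \<open>p q\<^sup>*\<close> with paths \<open>p\<close> and \<open>q\<close>
  such that \<open>q\<close> has length at most \<open>n\<close>.\<close>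

primrec ghost_span :: "nat \<Rightarrow> (('a, 'b) generator fword \<Rightarrow>\<^sub>0 'r::ring_1) set" where
  "ghost_span 0 = {x. \<exists>a\<in>path_span. x \<doteq> a}"
| "ghost_span (Suc n) = {x. \<exists>a\<in>path_span. \<exists>F b. finite F \<and> F \<subseteq> arcs G \<and> (\<forall>f\<in>F. b f \<in> ghost_span n) \<and>
      x \<doteq> a + (\<Sum>f\<in>F. b f * gen (Ghost f))}"

lemma ghost_span_SucI:
  assumes "a \<in> path_span" "finite F" "F \<subseteq> arcs G" "\<And>f. f \<in> F \<Longrightarrow> b f \<in> ghost_span n"
    and "x \<doteq> a + (\<Sum>f\<in>F. b f * gen (Ghost f))"
  shows "x \<in> ghost_span (Suc n)"
  unfolding ghost_span.simps using assms by (intro CollectI bexI[of _ a] exI[of _ F] exI[of _ b]) auto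

lemma ghost_span_SucE:
  assumes "x \<in> ghost_span (Suc n)"
  obtains a F b where "a \<in> path_span" "finite F" "F \<subseteq> arcs G" "\<And>f. f \<in> F \<Longrightarrow> b f \<in> ghost_span n"
    "x \<doteq> a + (\<Sum>f\<in>F. b f * gen (Ghost f))"
  using assms unfolding ghost_span.simps by blast

lemma ghost_span_cong: "x \<in> ghost_span n \<Longrightarrow> y \<doteq> x \<Longrightarrow> y \<in> ghost_span n"
  by (cases n) (auto, (blast intro: lpa_eq_trans)+)

lemma path_span_subset_ghost_span: "a \<in> path_span \<Longrightarrow> a \<in> ghost_span n"
  by (cases n) (auto intro!: bexI[of _ a] exI[of _ "{}"])

lemma ghost_span_Suc: "x \<in> ghost_span n \<Longrightarrow> x \<in> ghost_span (Suc n)"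
proof (induction n arbitrary: x)
  case 0
  then show ?case
    by (auto intro: ghost_span_cong path_span_subset_ghost_span simp del: ghost_span.simps(2))
next
  case (Suc n)
  obtain a F b where x: "a \<in> path_span" "finite F" "F \<subseteq> arcs G" "\<And>f. f \<in> F \<Longrightarrow> b f \<in> ghost_span n"
      "x \<doteq> a + (\<Sum>f\<in>F. b f * gen (Ghost f))"
    using ghost_span_SucE[OF Suc.prems] by blast
  show ?case
    by (rule ghost_span_SucI[OF x(1-3) _ x(5)]) (rule Suc.IH[OF x(4)])
qed

lemma ghost_span_mono: "m \<le> n \<Longrightarrow> x \<in> ghost_span m \<Longrightarrow> x \<in> ghost_span n"
  by (induction n rule: dec_induct) (auto intro: ghost_span_Suc simp del: ghost_span.simps)

lemma ghost_span_zero: "0 \<in> ghost_span n"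
  by (intro path_span_subset_ghost_span path_span_zero)

lemma ghost_span_add: "x \<in> ghost_span n \<Longrightarrow> y \<in> ghost_span n \<Longrightarrow> x + y \<in> ghost_span n"
proof (induction n arbitrary: x y)
  case 0
  then show ?case
    by (auto intro: path_span_add lpa_eq_add)
next
  case (Suc n)
  obtain a F b where x: "a \<in> path_span" "finite F" "F \<subseteq> arcs G" "\<And>f. f \<in> F \<Longrightarrow> b f \<in> ghost_span n"
      "x \<doteq> a + (\<Sum>f\<in>F. b f * gen (Ghost f))"
    using ghost_span_SucE[OF Suc.prems(1)] by blast
  obtain a' F' b' where y: "a' \<in> path_span" "finite F'" "F' \<subseteq> arcs G" "\<And>f. f \<in> F' \<Longrightarrow> b' f \<in> ghost_span n"
      "y \<doteq> a' + (\<Sum>f\<in>F'. b' f * gen (Ghost f))"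
    using ghost_span_SucE[OF Suc.prems(2)] by blast
  \<comment> \<open>Both coefficient families are extended by 0 to the union of the two index sets,
    so that they can be added arc by arc.\<close>
  define B where "B f = (if f \<in> F then b f else 0)" for f
  define B' where "B' f = (if f \<in> F' then b' f else 0)" for f
  have "(\<Sum>f\<in>F \<union> F'. B f * gen (Ghost f)) = (\<Sum>f\<in>F. b f * gen (Ghost f))"
    using x y by (intro sum.mono_neutral_cong_right) (auto simp: B_def)
  moreover have "(\<Sum>f\<in>F \<union> F'. B' f * gen (Ghost f)) = (\<Sum>f\<in>F'. b' f * gen (Ghost f))"
    using x y by (intro sum.mono_neutral_cong_right) (auto simp: B'_def)
  ultimately have "(\<Sum>f\<in>F \<union> F'. (B f + B' f) * gen (Ghost f))
      = (\<Sum>f\<in>F. b f * gen (Ghost f)) + (\<Sum>f\<in>F'. b' f * gen (Ghost f))"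
    by (simp add: distrib_right sum.distrib)
  then have "x + y \<doteq> (a + a') + (\<Sum>f\<in>F \<union> F'. (B f + B' f) * gen (Ghost f))"
    using lpa_eq_add[OF x(5) y(5)] by (simp add: algebra_simps)
  moreover have "B f + B' f \<in> ghost_span n" for f
    using x(4) y(4) by (intro Suc.IH) (auto simp: B_def B'_def ghost_span_zero)
  ultimately show ?case
    using x y by (intro ghost_span_SucI[of "a + a'"]) (auto intro: path_span_add simp del: ghost_span.simps)
qed

lemma ghost_span_mult_vert:
  assumes "x \<in> ghost_span n" "v \<in> verts G"
  shows "x * gen (Vert v) \<in> ghost_span n"
proof (cases n)
  case 0
  with assms obtain a where "a \<in> path_span" "x \<doteq> a" by auto
  then have "x * gen (Vert v) \<doteq> restrict_words (path_word_to v) a" "restrict_words (path_word_to v) a \<in> path_span"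
    using assms by (auto intro: lpa_eq_trans lpa_eq_rmult path_span_mult_vert path_span_restrict_words)
  then show ?thesis
    using ghost_span_cong path_span_subset_ghost_span by blast
next
  case (Suc m)
  then obtain a F b where x: "a \<in> path_span" "finite F" "F \<subseteq> arcs G" "\<And>f. f \<in> F \<Longrightarrow> b f \<in> ghost_span m"
      "x \<doteq> a + (\<Sum>f\<in>F. b f * gen (Ghost f))"
    using assms ghost_span_SucE by blast
  define b' where "b' f = (if tail G f = v then b f else 0)" for f
  have "x * gen (Vert v) \<doteq> (a + (\<Sum>f\<in>F. b f * gen (Ghost f))) * gen (Vert v)"
    by (rule lpa_eq_rmult) (rule x)
  also have "\<dots> = a * gen (Vert v) + (\<Sum>f\<in>F. b f * (gen (Ghost f) * gen (Vert v)))"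
    by (simp add: distrib_right sum_distrib_right mult.assoc)
  also have "\<dots> \<doteq> restrict_words (path_word_to v) a + (\<Sum>f\<in>F. b f * (if tail G f = v then gen (Ghost f) else 0))"
    using x assms by (intro lpa_eq_add path_span_mult_vert lpa_eq_sum lpa_eq_lmult ghost_vert) auto
  also have "\<dots> = restrict_words (path_word_to v) a + (\<Sum>f\<in>F. b' f * gen (Ghost f))"
    by (simp add: b'_def if_distrib[of "\<lambda>c. c * _"] if_distrib[of "\<lambda>c. _ * c"] cong: if_cong)
  finally have "x * gen (Vert v) \<doteq> restrict_words (path_word_to v) a + (\<Sum>f\<in>F. b' f * gen (Ghost f))" .
  moreover have "b' f \<in> ghost_span m" if "f \<in> F" for f
    using x that by (simp add: b'_def ghost_span_zero)
  ultimately show ?thesis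
    unfolding Suc using x path_span_restrict_words by (intro ghost_span_SucI)
qed

lemma ghost_sum_mult_edge:
  assumes "finite F" "F \<subseteq> arcs G" "e \<in> arcs G"
  shows "(\<Sum>f\<in>F. b f * gen (Ghost f)) * gen (Edge e)
    \<doteq> (if e \<in> F then b e * gen (Vert (head G e)) else 0)"
proof -
  have "(\<Sum>f\<in>F. b f * gen (Ghost f)) * gen (Edge e) = (\<Sum>f\<in>F. b f * (gen (Ghost f) * gen (Edge e)))"
    by (simp add: sum_distrib_right mult.assoc)
  also have "\<dots> \<doteq> (\<Sum>f\<in>F. b f * (if f = e then gen (Vert (head G f)) else 0))"
    using assms by (intro lpa_eq_sum lpa_eq_lmult ghost_edge) auto
  also have "\<dots> = (if e \<in> F then b e * gen (Vert (head G e)) else 0)"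
    using assms by (simp add: if_distrib[of "\<lambda>c. _ * c"] cong: if_cong)
  finally show ?thesis .
qed

text \<open>An edge cancels the last ghost letter or annihilates the term. At n = 0 the truncated
  difference is again 0, which is right because only paths are present and they stay paths.\<close>

lemma ghost_span_mult_edge:
  assumes "x \<in> ghost_span n" "e \<in> arcs G"
  shows "x * gen (Edge e) \<in> ghost_span (n - 1)"
proof (cases n)
  case 0
  with assms obtain a where "a \<in> path_span" "x \<doteq> a" by auto
  with assms show ?thesis
    using path_span_mult_edge_eq[of a e] lpa_eq_rmult[of x a "gen (Edge e)"]
    by (meson ghost_span_cong lpa_eq_trans path_span_subset_ghost_span)
next
  case (Suc m)
  then obtain a F b where x: "a \<in> path_span" "finite F" "F \<subseteq> arcs G" "\<And>f. f \<in> F \<Longrightarrow> b f \<in> ghost_span m"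
      "x \<doteq> a + (\<Sum>f\<in>F. b f * gen (Ghost f))"
    using assms ghost_span_SucE by blast
  let ?b = "if e \<in> F then b e * gen (Vert (head G e)) else 0"
  let ?a = "restrict_words (path_word_to (tail G e)) a * gen (Edge e)"
  have "x * gen (Edge e) \<doteq> (a + (\<Sum>f\<in>F. b f * gen (Ghost f))) * gen (Edge e)"
    by (rule lpa_eq_rmult) (rule x)
  also have "\<dots> = a * gen (Edge e) + (\<Sum>f\<in>F. b f * gen (Ghost f)) * gen (Edge e)"
    by (rule distrib_right)
  also have "\<dots> \<doteq> ?a + ?b"
    using x assms by (intro lpa_eq_add path_span_mult_edge_eq ghost_sum_mult_edge)
  finally have "x * gen (Edge e) \<doteq> ?a + ?b" .
  moreover have "?a \<in> ghost_span m"
    using x assms by (intro path_span_subset_ghost_span path_span_mult_edge_eq)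
  moreover have "?b \<in> ghost_span m"
    using x assms by (simp add: ghost_span_mult_vert ghost_span_zero)
  ultimately show ?thesis
    unfolding Suc by (auto intro: ghost_span_cong ghost_span_add simp del: ghost_span.simps)
qed

lemma ghost_span_mult_ghost:
  assumes "x \<in> ghost_span n" "e \<in> arcs G"
  shows "x * gen (Ghost e) \<in> ghost_span (Suc n)"
proof -
  have "x * gen (Ghost e) \<doteq> 0 + (\<Sum>f\<in>{e}. x * gen (Ghost f))"
    by simp
  then show ?thesis
    using assms path_span_zero by (intro ghost_span_SucI[of 0 "{e}" "\<lambda>_. x"]) auto
qed

text \<open>The letters are appended on the right one at a time, starting from the trivial path at
  u; only ghost letters raise the bound.\<close>

lemma word_in_ghost_span:
  assumes "u \<in> verts G" "set gs \<subseteq> generators G"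
  shows "\<exists>n. Poly_Mapping.single (FWord (Vert u # gs)) c \<in> ghost_span n"
  using assms(2)
proof (induction gs rule: rev_induct)
  case Nil
  show ?case
    using path_span_subset_ghost_span[OF path_span_vert[OF assms(1)]] by blast
next
  case (snoc g gs)
  let ?x = "Poly_Mapping.single (FWord (Vert u # gs)) c"
  from snoc obtain n where "?x \<in> ghost_span n"
    by auto
  moreover from snoc.prems have "g \<in> generators G"
    by simp
  ultimately have "\<exists>m. ?x * gen g \<in> ghost_span m"
    unfolding generators_def
    using ghost_span_mult_vert[of ?x n] ghost_span_mult_edge[of ?x n] ghost_span_mult_ghost[of ?x n]
    by blast
  then show ?case
    by (simp add: single_mult_gen)
qed

lemma generator_left_unit:
  assumes "g \<in> generators G"
  obtains u where "u \<in> verts G" "gen (Vert u) * gen g \<doteq> gen g"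
proof -
  consider (vert) v where "g = Vert v" "v \<in> verts G" | (edge) f where "g = Edge f" "f \<in> arcs G"
    | (ghost) f where "g = Ghost f" "f \<in> arcs G"
    using assms unfolding generators_def by blast
  then show thesis
  proof cases
    case vert
    then show ?thesis using that[of v] vert_vert[of v v] by simp
  next
    case edge
    then show ?thesis using that[of "tail G f"] tail_edge[of f] by simp
  next
    case ghost
    then show ?thesis using that[of "head G f"] head_ghost[of f] by simp
  qed
qed

lemma free_algebra_ghost_span:
  assumes "x \<in> carrier (free_algebra (generators G))"
  obtains n where "x \<in> ghost_span n"
proof -
  have word: "\<exists>n. Poly_Mapping.single w c \<in> ghost_span n"
    if w: "w \<noteq> 0" "set (letters w) \<subseteq> generators G" for w and c :: 'c
  proof -
    \<comment> \<open>A left unit of the first letter supplies the leading vertex that path words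
      require.\<close>
    obtain g gs where gs: "w = FWord (g # gs)"
      using w by (metis fword.collapse list.exhaust zero_fword_def)
    then obtain u where u: "u \<in> verts G" "gen (Vert u) * gen g \<doteq> (gen g :: ('a, 'b) generator fword \<Rightarrow>\<^sub>0 'c)"
      using w generator_left_unit[of g] by auto
    obtain n where "Poly_Mapping.single (FWord (Vert u # g # gs)) c \<in> ghost_span n"
      using word_in_ghost_span[of u "g # gs"] u w gs by auto
    moreover have "Poly_Mapping.single w c \<doteq> Poly_Mapping.single (FWord (Vert u # g # gs)) c"
      using lpa_eq_rmult[OF lpa_eq_sym[OF u(2)], of "Poly_Mapping.single (FWord gs) c"]
      by (simp add: gs gen_mult_single mult.assoc)
    ultimately show ?thesis
      using ghost_span_cong by blast
  qed
  have "\<exists>n. (\<Sum>w\<in>W. Poly_Mapping.single w (Poly_Mapping.lookup x w)) \<in> ghost_span n"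
    if "finite W" "W \<subseteq> Poly_Mapping.keys x" for W
    using that
  proof (induction W)
    case empty
    show ?case
      using ghost_span_zero by auto
  next
    case (insert w W)
    obtain n where n: "(\<Sum>w\<in>W. Poly_Mapping.single w (Poly_Mapping.lookup x w)) \<in> ghost_span n"
      using insert by auto
    have "\<exists>m. Poly_Mapping.single w (Poly_Mapping.lookup x w) \<in> ghost_span m"
      using assms insert.prems by (intro word) (auto simp: mem_free_algebra)
    then obtain m where m: "Poly_Mapping.single w (Poly_Mapping.lookup x w) \<in> ghost_span m"
      by blast
    have "Poly_Mapping.single w (Poly_Mapping.lookup x w) + (\<Sum>w\<in>W. Poly_Mapping.single w (Poly_Mapping.lookup x w))
        \<in> ghost_span (max n m)"
      by (intro ghost_span_add ghost_span_mono[OF _ m] ghost_span_mono[OF _ n]) auto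
    then show ?case
      using insert.hyps by auto
  qed
  then have "\<exists>n. x \<in> ghost_span n"
    using poly_mapping_sum_single[of x] finite_keys[of x] by (metis order_refl)
  with that show thesis by blast
qed

section \<open>Reduction to paths\<close>

lemma free_algebra_generators:
  "v \<in> verts G \<Longrightarrow> gen (Vert v) \<in> carrier (free_algebra (generators G))"
  "f \<in> arcs G \<Longrightarrow> gen (Edge f) \<in> carrier (free_algebra (generators G))"
  "f \<in> arcs G \<Longrightarrow> gen (Ghost f) \<in> carrier (free_algebra (generators G))"
  by (auto intro!: free_algebra_gen simp: generators_def)

lemma generator_right_unit:
  assumes "g \<in> generators G"
  obtains u where "u \<in> verts G" "gen g * gen (Vert u) \<doteq> gen g"
proof -
  consider (vert) v where "g = Vert v" "v \<in> verts G" | (edge) f where "g = Edge f" "f \<in> arcs G"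
    | (ghost) f where "g = Ghost f" "f \<in> arcs G"
    using assms unfolding generators_def by blast
  then show thesis
  proof cases
    case vert
    then show ?thesis using that[of v] vert_vert[of v v] by simp
  next
    case edge
    then show ?thesis using that[of "head G f"] edge_head[of f] by simp
  next
    case ghost
    then show ?thesis using that[of "tail G f"] ghost_tail[of f] by simp
  qed
qed

lemma sum_verts_left_unit:
  assumes "finite V" "V \<subseteq> verts G" "u \<in> V"
  shows "gen (Vert u) * (\<Sum>v\<in>V. gen (Vert v)) \<doteq> gen (Vert u)"
proof -
  have "gen (Vert u) * (\<Sum>v\<in>V. gen (Vert v)) = (\<Sum>v\<in>V. gen (Vert u) * gen (Vert v))"
    by (rule sum_distrib_left)
  also have "\<dots> \<doteq> (\<Sum>v\<in>V. if u = v then gen (Vert u) else 0)"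
    using assms by (intro lpa_eq_sum vert_vert) auto
  also have "\<dots> = gen (Vert u)"
    using assms by simp
  finally show ?thesis .
qed

text \<open>The algebra has local units: every word has a vertex as right unit, and the sum of the
  finitely many vertices so obtained from the words of x is a right unit of x. If all products with
  these vertices vanished, so would x.\<close>

lemma nonzero_mult_vert:
  assumes x: "x \<in> carrier (free_algebra (generators G))" and nz: "\<not> x \<doteq> 0"
  obtains v where "v \<in> verts G" "\<not> x * gen (Vert v) \<doteq> 0"
proof -
  let ?c = "Poly_Mapping.lookup x"
  have "\<exists>u\<in>verts G. Poly_Mapping.single w (?c w) * gen (Vert u) \<doteq> Poly_Mapping.single w (?c w)"
    if "w \<in> Poly_Mapping.keys x" for w
  proof -
    have w: "w \<noteq> 0" "set (letters w) \<subseteq> generators G"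
      using x that by (auto simp: mem_free_algebra)
    then obtain gs g where gs: "w = FWord (gs @ [g])"
      by (metis fword.collapse rev_exhaust zero_fword_def)
    with w have "g \<in> generators G" by simp
    then obtain u where u: "u \<in> verts G" "gen g * gen (Vert u) \<doteq> (gen g :: ('a, 'b) generator fword \<Rightarrow>\<^sub>0 'c)"
      by (rule generator_right_unit)
    have "Poly_Mapping.single w (?c w) * gen (Vert u) = Poly_Mapping.single (FWord gs) (?c w) * (gen g * gen (Vert u))"
      by (simp add: gs single_mult_gen flip: mult.assoc)
    also have "\<dots> \<doteq> Poly_Mapping.single (FWord gs) (?c w) * gen g"
      by (rule lpa_eq_lmult) (rule u)
    also have "\<dots> = Poly_Mapping.single w (?c w)"
      by (simp add: gs single_mult_gen)
    finally show ?thesis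
      using u by blast
  qed
  then obtain u where u: "\<And>w. w \<in> Poly_Mapping.keys x \<Longrightarrow> u w \<in> verts G"
    "\<And>w. w \<in> Poly_Mapping.keys x \<Longrightarrow> Poly_Mapping.single w (?c w) * gen (Vert (u w)) \<doteq> Poly_Mapping.single w (?c w)"
    by metis
  define V where "V = u ` Poly_Mapping.keys x"
  have V: "finite V" "V \<subseteq> verts G"
    using u by (auto simp: V_def)
  have "Poly_Mapping.single w (?c w) * (\<Sum>v\<in>V. gen (Vert v)) \<doteq> Poly_Mapping.single w (?c w)"
    if w: "w \<in> Poly_Mapping.keys x" for w
  proof -
    have "Poly_Mapping.single w (?c w) * (\<Sum>v\<in>V. gen (Vert v))
        \<doteq> Poly_Mapping.single w (?c w) * gen (Vert (u w)) * (\<Sum>v\<in>V. gen (Vert v))"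
      by (rule lpa_eq_rmult[OF lpa_eq_sym[OF u(2)[OF w]]])
    also have "\<dots> = Poly_Mapping.single w (?c w) * (gen (Vert (u w)) * (\<Sum>v\<in>V. gen (Vert v)))"
      by (rule mult.assoc)
    also have "\<dots> \<doteq> Poly_Mapping.single w (?c w) * gen (Vert (u w))"
      using w V by (intro lpa_eq_lmult sum_verts_left_unit) (auto simp: V_def)
    also have "\<dots> \<doteq> Poly_Mapping.single w (?c w)"
      by (rule u(2)[OF w])
    finally show ?thesis .
  qed
  then have "(\<Sum>w\<in>Poly_Mapping.keys x. Poly_Mapping.single w (?c w) * (\<Sum>v\<in>V. gen (Vert v)))
      \<doteq> (\<Sum>w\<in>Poly_Mapping.keys x. Poly_Mapping.single w (?c w))"
    by (rule lpa_eq_sum)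
  then have "x * (\<Sum>v\<in>V. gen (Vert v)) \<doteq> x"
    by (simp flip: sum_distrib_right poly_mapping_sum_single)
  then have sum: "x \<doteq> (\<Sum>v\<in>V. x * gen (Vert v))"
    by (simp add: lpa_eq_sym flip: sum_distrib_left)
  have "\<exists>v\<in>V. \<not> x * gen (Vert v) \<doteq> 0"
  proof (rule ccontr)
    assume "\<not> (\<exists>v\<in>V. \<not> x * gen (Vert v) \<doteq> 0)"
    then have "(\<Sum>v\<in>V. x * gen (Vert v)) \<doteq> (\<Sum>v\<in>V. 0)"
      by (intro lpa_eq_sum) auto
    with sum have "x \<doteq> (\<Sum>v\<in>V. 0)"
      by (rule lpa_eq_trans)
    with nz show False by simp
  qed
  with that V show thesis by blast
qed

lemma ghost_sum_mult_vert:
  assumes "F \<subseteq> arcs G" "v \<in> verts G"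
  shows "(\<Sum>f\<in>F. b f * gen (Ghost f)) * gen (Vert v)
    \<doteq> (\<Sum>f\<in>F. if tail G f = v then b f * gen (Ghost f) else 0)"
proof -
  have "(\<Sum>f\<in>F. b f * gen (Ghost f)) * gen (Vert v) = (\<Sum>f\<in>F. b f * (gen (Ghost f) * gen (Vert v)))"
    by (simp add: sum_distrib_right mult.assoc)
  also have "\<dots> \<doteq> (\<Sum>f\<in>F. b f * (if tail G f = v then gen (Ghost f) else 0))"
    using assms by (intro lpa_eq_sum lpa_eq_lmult ghost_vert) auto
  also have "\<dots> = (\<Sum>f\<in>F. if tail G f = v then b f * gen (Ghost f) else 0)"
    by (intro sum.cong) auto
  finally show ?thesis .
qed

text \<open>The head of f is a left unit of its ghost. Thus the coefficient that an edge uncovers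
  decides whether the ghost term itself vanishes.\<close>

lemma ghost_cancel:
  assumes "b * gen (Vert (head G f)) \<doteq> 0" "f \<in> arcs G"
  shows "b * gen (Ghost f) \<doteq> 0"
proof -
  have "b * gen (Ghost f) \<doteq> b * (gen (Vert (head G f)) * gen (Ghost f))"
    using assms by (intro lpa_eq_lmult lpa_eq_sym[OF head_ghost])
  also have "\<dots> = b * gen (Vert (head G f)) * gen (Ghost f)"
    by (simp add: mult.assoc)
  also have "\<dots> \<doteq> 0 * gen (Ghost f)"
    using assms by (intro lpa_eq_rmult)
  finally show ?thesis by simp
qed

text \<open>Induction on the ghost length. The result a is nonzero as a polynomial, which is weaker
  at this point than being nonzero modulo the relations and is all that the leading coefficient
  argument requires.\<close>

lemma reduce_to_path_span:
  assumes "x \<in> ghost_span n" "x \<in> carrier (free_algebra (generators G))" "\<not> x \<doteq> 0"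
  shows "\<exists>q\<in>carrier (free_algebra (generators G)). \<exists>a\<in>path_span. a \<noteq> 0 \<and> x * q \<doteq> a"
  using assms
proof (induction n arbitrary: x)
  case 0
  then obtain v where v: "v \<in> verts G" "\<not> x * gen (Vert v) \<doteq> 0"
    using nonzero_mult_vert by blast
  obtain a where a: "a \<in> path_span" "x \<doteq> a"
    using 0 by auto
  let ?a = "restrict_words (path_word_to v) a"
  have "x * gen (Vert v) \<doteq> ?a"
    using lpa_eq_trans[OF lpa_eq_rmult[OF a(2)] path_span_mult_vert[OF a(1) v(1)]] .
  then show ?case
    using v a by (intro bexI[of _ "gen (Vert v)"] bexI[of _ ?a])
      (auto intro: free_algebra_generators path_span_restrict_words)
next
  case (Suc n)
  show ?case
  proof (cases "\<exists>e\<in>arcs G. \<not> x * gen (Edge e) \<doteq> 0")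
    case True
    then obtain e where e: "e \<in> arcs G" "\<not> x * gen (Edge e) \<doteq> 0" by blast
    have "x * gen (Edge e) \<in> ghost_span n"
      using ghost_span_mult_edge[OF Suc.prems(1) e(1)] by simp
    then obtain q a where "q \<in> carrier (free_algebra (generators G))" "a \<in> path_span" "a \<noteq> 0"
        "x * gen (Edge e) * q \<doteq> a"
      using Suc.IH[OF _ _ e(2)] Suc.prems(2) e(1) free_algebra_mult free_algebra_generators(2) by blast
    then show ?thesis
      using e by (intro bexI[of _ "gen (Edge e) * q"] bexI[of _ a])
        (auto intro: free_algebra_mult free_algebra_generators simp: mult.assoc)
  next
    \<comment> \<open>All edges annihilate x. Then x is compared with its expression at a single
      vertex v, and the number of arcs leaving v decides.\<close>
    case False
    then have zero: "x * gen (Edge e) \<doteq> 0" if "e \<in> arcs G" for e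
      using that by blast
    obtain v where v: "v \<in> verts G" "\<not> x * gen (Vert v) \<doteq> 0"
      using Suc.prems nonzero_mult_vert by blast
    obtain a F b where x: "a \<in> path_span" "finite F" "F \<subseteq> arcs G" "\<And>f. f \<in> F \<Longrightarrow> b f \<in> ghost_span n"
        "x \<doteq> a + (\<Sum>f\<in>F. b f * gen (Ghost f))"
      using ghost_span_SucE[OF Suc.prems(1)] by blast
    let ?a = "restrict_words (path_word_to v) a"
    have "x * gen (Vert v) \<doteq> a * gen (Vert v) + (\<Sum>f\<in>F. b f * gen (Ghost f)) * gen (Vert v)"
      using lpa_eq_rmult[OF x(5)] by (simp add: distrib_right)
    also have "\<dots> \<doteq> ?a + (\<Sum>f\<in>F. if tail G f = v then b f * gen (Ghost f) else 0)"
      using x v by (intro lpa_eq_add path_span_mult_vert ghost_sum_mult_vert)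
    finally have xv: "x * gen (Vert v) \<doteq> ?a + (\<Sum>f\<in>F. if tail G f = v then b f * gen (Ghost f) else 0)" .
    have xe: "x * gen (Edge e) \<doteq> ?a * gen (Edge e) + (if e \<in> F then b e * gen (Vert (head G e)) else 0)"
      if e: "e \<in> arcs G" "tail G e = v" for e
    proof -
      have "x * gen (Edge e) \<doteq> a * gen (Edge e) + (\<Sum>f\<in>F. b f * gen (Ghost f)) * gen (Edge e)"
        using lpa_eq_rmult[OF x(5)] by (simp add: distrib_right)
      also have "\<dots> \<doteq> ?a * gen (Edge e) + (if e \<in> F then b e * gen (Vert (head G e)) else 0)"
        using path_span_mult_edge_eq(2)[OF x(1) e(1)] ghost_sum_mult_edge[OF x(2,3) e(1)]
        unfolding e(2) by (rule lpa_eq_add)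
      finally show ?thesis .
    qed
    consider (sink) "out_arcs G v = {}" | (regular) "out_arcs G v \<noteq> {}" "finite (out_arcs G v)"
      | (infinite_emitter) "infinite (out_arcs G v)" by blast
    then show ?thesis
    proof cases
      \<comment> \<open>A ghost letter survives multiplication by v only if its arc has tail v, so x
        v is already a combination of paths.\<close>
      case sink
      have "tail G f \<noteq> v" if "f \<in> F" for f
      proof
        assume "tail G f = v"
        then have "f \<in> out_arcs G v"
          using x(3) that by (simp add: subset_iff)
        with sink show False by simp
      qed
      then have "(\<Sum>f\<in>F. if tail G f = v then b f * gen (Ghost f) else 0) = 0"
        by (intro sum.neutral) auto
      with xv have "x * gen (Vert v) \<doteq> ?a" by simp
      then show ?thesis
        using v x by (intro bexI[of _ "gen (Vert v)"] bexI[of _ ?a])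
          (auto intro: free_algebra_generators path_span_restrict_words)
    next
      \<comment> \<open>The relation at v writes x v as the sum of the products of x f with the
        ghost of f, all of which vanish, against the choice of v.\<close>
      case regular
      have "x * gen (Vert v) \<doteq> x * (\<Sum>f\<in>out_arcs G v. gen (Edge f) * gen (Ghost f))"
        using v regular by (intro lpa_eq_lmult lpa_eq_sym[OF sum_edge_ghost])
      also have "\<dots> = (\<Sum>f\<in>out_arcs G v. x * gen (Edge f) * gen (Ghost f))"
        by (simp add: sum_distrib_left mult.assoc)
      also have "\<dots> \<doteq> (\<Sum>f\<in>out_arcs G v. 0 * gen (Ghost f))"
        by (intro lpa_eq_sum lpa_eq_rmult zero) simp
      finally show ?thesis
        using v by simp
    next
      \<comment> \<open>The finite set F misses some arc e leaving v, and x e has no ghost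
        contribution.\<close>
      case infinite_emitter
      then have "infinite (out_arcs G v - F)"
        using x(2) by simp
      then obtain e where "e \<in> out_arcs G v - F"
        by (metis all_not_in_conv finite.emptyI)
      then have e: "e \<in> arcs G" "tail G e = v" "e \<notin> F"
        by auto
      \<comment> \<open>If no path of a ended at v, then x f = 0 would remove every ghost term with
        tail v, and x v would vanish.\<close>
      have nz: "?a \<noteq> 0"
      proof
        assume a: "?a = 0"
        have "b f * gen (Ghost f) \<doteq> 0" if f: "f \<in> F" "tail G f = v" for f
        proof (rule ghost_cancel)
          show f_arc: "f \<in> arcs G" using f x by blast
          have "x * gen (Edge f) \<doteq> b f * gen (Vert (head G f))"
            using xe[OF f_arc f(2)] f unfolding a by simp
          then show "b f * gen (Vert (head G f)) \<doteq> 0"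
            using zero[OF f_arc] lpa_eq_trans lpa_eq_sym by blast
        qed
        then have "(\<Sum>f\<in>F. if tail G f = v then b f * gen (Ghost f) else 0) \<doteq> (\<Sum>f\<in>F. 0)"
          by (intro lpa_eq_sum) auto
        then have "x * gen (Vert v) \<doteq> 0"
          using xv unfolding a by (auto intro: lpa_eq_trans)
        with v(2) show False ..
      qed
      \<comment> \<open>This product is congruent to x e and so is null by \<open>zero\<close>, but
        as a polynomial it is nonzero, which proves the claim. That these two facts exclude each
        other only follows from \<open>path_span_leading_coefficient\<close> and
        \<open>vert_plus_positive_nonzero\<close>.\<close>
      have "?a * gen (Edge e) \<in> path_span" "?a * gen (Edge e) \<noteq> 0"
        using path_span_mult_edge_eq(1,3)[OF x(1) e(1)] nz unfolding e(2) by auto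
      moreover have "x * gen (Edge e) \<doteq> ?a * gen (Edge e)"
        using xe[OF e(1,2)] e by simp
      ultimately show ?thesis
        using e free_algebra_generators(2)[of e] by blast
    qed
  qed
qed

section \<open>Cancelling paths against ghost paths\<close>

abbreviation ghost_path :: "'a \<Rightarrow> 'b list \<Rightarrow> ('a, 'b) generator fword" where
  "ghost_path u p \<equiv> FWord (map Ghost (rev p) @ [Vert u])"

text \<open>Reversal puts the ghost of the first edge of p next to the first edge of p', so the
  innermost pair cancels or gives 0. Equal lengths leave no unmatched letters.\<close>

lemma ghost_edge_paths:
  assumes "awalk u p v" "awalk u p' v'" "length p = length p'"
  shows "Poly_Mapping.single (FWord (map Ghost (rev p))) 1 * gen (Vert u) * Poly_Mapping.single (FWord (map Edge p')) 1
    \<doteq> (if p = p' then gen (Vert v) else (0 :: ('a, 'b) generator fword \<Rightarrow>\<^sub>0 'r::ring_1))"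
  using assms(3,1,2)
proof (induction p p' arbitrary: u rule: list_induct2)
  case Nil
  then show ?case
    by (auto simp: awalk_Nil_iff gen_def mult_single plus_fword_def)
next
  case (Cons f p f' p')
  let ?gh = "\<lambda>p. Poly_Mapping.single (FWord (map Ghost (rev p))) 1 :: ('a, 'b) generator fword \<Rightarrow>\<^sub>0 'r"
  let ?ed = "\<lambda>p. Poly_Mapping.single (FWord (map Edge p)) 1 :: ('a, 'b) generator fword \<Rightarrow>\<^sub>0 'r"
  have f: "f \<in> arcs G" "f' \<in> arcs G" "tail G f = u" "tail G f' = u"
    and walks: "awalk (head G f) p v" "awalk (head G f') p' v'"
    using Cons.prems by (auto simp: awalk_Cons_iff)
  have "?gh (f # p) * gen (Vert u) * ?ed (f' # p') = ?gh p * (gen (Ghost f) * (gen (Vert u) * gen (Edge f'))) * ?ed p'"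
    by (simp add: mult_single gen_def plus_fword_def)
  also have "\<dots> \<doteq> ?gh p * (gen (Ghost f) * gen (Edge f')) * ?ed p'"
    using tail_edge[OF f(2)] f by (intro lpa_eq_lmult lpa_eq_rmult) auto
  also have "\<dots> \<doteq> ?gh p * (if f = f' then gen (Vert (head G f)) else 0) * ?ed p'"
    using f by (intro lpa_eq_lmult lpa_eq_rmult ghost_edge)
  also have "\<dots> \<doteq> (if f # p = f' # p' then gen (Vert v) else 0)"
    using Cons.IH[of "head G f"] walks by auto
  finally show ?case .
qed

lemma ghost_path_path_word:
  fixes c :: "'r::ring_1"
  assumes p: "awalk u p v" "awalk u' p' v'" "length p = length p'"
  shows "Poly_Mapping.single (ghost_path u p) 1 * Poly_Mapping.single (path_word u' p') c
    \<doteq> (if path_word u p = path_word u' p' then Poly_Mapping.single 0 c * gen (Vert v) else 0)"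
proof -
  let ?gh = "Poly_Mapping.single (FWord (map Ghost (rev p))) 1 :: ('a, 'b) generator fword \<Rightarrow>\<^sub>0 'r"
  let ?ed = "Poly_Mapping.single (FWord (map Edge p')) 1 :: ('a, 'b) generator fword \<Rightarrow>\<^sub>0 'r"
  have "Poly_Mapping.single (ghost_path u p) 1 * Poly_Mapping.single (path_word u' p') c
      = Poly_Mapping.single 0 c * (?gh * (gen (Vert u) * gen (Vert u')) * ?ed)"
    by (simp add: mult_single gen_def plus_fword_def path_word_def zero_fword_def)
  also have "\<dots> \<doteq> Poly_Mapping.single 0 c * (?gh * (if u = u' then gen (Vert u) else 0) * ?ed)"
    using p by (intro lpa_eq_lmult lpa_eq_rmult vert_vert) auto
  also have "\<dots> \<doteq> Poly_Mapping.single 0 c * (if path_word u p = path_word u' p' then gen (Vert v) else 0)"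
    using ghost_edge_paths[of u p v p' v'] p by (intro lpa_eq_lmult) (auto simp: path_word_eq_iff)
  also have "\<dots> = (if path_word u p = path_word u' p' then Poly_Mapping.single 0 c * gen (Vert v) else 0)"
    by simp
  finally show ?thesis .
qed

section \<open>Positive degree and leading coefficients\<close>

lemma positive_part_add: "y \<in> positive_part \<Longrightarrow> z \<in> positive_part \<Longrightarrow> y + z \<in> positive_part"
  using keys_add[of y z] by (auto simp: positive_part_def)

lemma positive_part_zero: "0 \<in> positive_part"
  by (simp add: positive_part_def)

lemma positive_part_sum: "(\<And>i. i \<in> I \<Longrightarrow> z i \<in> positive_part) \<Longrightarrow> sum z I \<in> positive_part"
  by (induction I rule: infinite_finite_induct) (auto intro: positive_part_add positive_part_zero)

lemma keys_multE:
  assumes "w \<in> Poly_Mapping.keys (p * q)"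
  obtains u v where "u \<in> Poly_Mapping.keys p" "v \<in> Poly_Mapping.keys q" "w = u + v"
  using keys_mult[of p q] assms by blast

lemma positive_part_mult:
  assumes "y \<in> positive_part" "\<And>w. w \<in> Poly_Mapping.keys z \<Longrightarrow> 0 \<le> word_degree w"
  shows "y * z \<in> positive_part" "z * y \<in> positive_part"
  using assms unfolding positive_part_def
  by (auto simp: word_degree_plus add_pos_nonneg add_nonneg_pos elim!: keys_multE)

lemma word_degree_path_word [simp]: "word_degree (path_word u p) = int (length p)"
  by (induction p) (simp_all add: word_degree_def path_word_def)

lemma word_degree_ghost_path [simp]: "word_degree (ghost_path u p) = - int (length p)"
  by (induction p) (simp_all add: word_degree_def)

lemma free_algebra_path_word:
  "awalk u p v \<Longrightarrow> Poly_Mapping.single (path_word u p) c \<in> carrier (free_algebra (generators G))"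
  by (rule free_algebra_single) (auto simp: path_word_def generators_def zero_fword_def awalk_def)

lemma free_algebra_ghost_path:
  "awalk u p v \<Longrightarrow> Poly_Mapping.single (ghost_path u p) c \<in> carrier (free_algebra (generators G))"
  by (rule free_algebra_single) (auto simp: generators_def zero_fword_def awalk_def)

text \<open>Cancelling a path of minimal length among those occurring in \<open>a\<close> leaves its coefficient at a
  vertex, and only paths of positive length otherwise.\<close>

lemma path_span_leading_coefficient:
  fixes a :: "('a, 'b) generator fword \<Rightarrow>\<^sub>0 'r::ring_1"
  assumes a: "a \<in> path_span" "a \<noteq> 0"
  obtains g v r z where "g \<in> carrier (free_algebra (generators G))" "v \<in> verts G" "r \<noteq> 0" "z \<in> positive_part"
    "g * a \<doteq> Poly_Mapping.single 0 r * gen (Vert v) + z"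
proof -
  let ?c = "Poly_Mapping.lookup a"
  have path: "\<exists>u p v. awalk u p v \<and> w = path_word u p" if "w \<in> Poly_Mapping.keys a" for w
    using that a(1) unfolding path_span_def path_word_to_def by blast
  obtain w1 where "w1 \<in> Poly_Mapping.keys a"
    using a(2) by (metis all_not_in_conv keys_eq_empty)
  \<comment> \<open>\<open>nat\<close> only provides a well-ordered measure: the degree of a path
    word is the length of the path.\<close>
  then obtain w0 where w0: "w0 \<in> Poly_Mapping.keys a"
      "\<And>w. w \<in> Poly_Mapping.keys a \<Longrightarrow> nat (word_degree w0) \<le> nat (word_degree w)"
    using ex_has_least_nat[of "\<lambda>w. w \<in> Poly_Mapping.keys a" w1 "\<lambda>w. nat (word_degree w)"] by blast
  obtain u p v where p: "awalk u p v" "w0 = path_word u p"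
    using path[OF w0(1)] by blast
  let ?g = "Poly_Mapping.single (ghost_path u p) 1 :: ('a, 'b) generator fword \<Rightarrow>\<^sub>0 'r"
  \<comment> \<open>Paths of the same length as p other than p itself are annihilated by the ghost
    path. All others are longer by minimality, so their unreduced products have positive
    degree.\<close>
  define z where "z = (\<Sum>w\<in>Poly_Mapping.keys a.
    if word_degree w = word_degree w0 then 0 else ?g * Poly_Mapping.single w (?c w))"
  have "?g * a = (\<Sum>w\<in>Poly_Mapping.keys a. ?g * Poly_Mapping.single w (?c w))"
    by (subst poly_mapping_sum_single[of a]) (simp add: sum_distrib_left)
  also have "\<dots> \<doteq> (\<Sum>w\<in>Poly_Mapping.keys a. (if w = w0 then Poly_Mapping.single 0 (?c w) * gen (Vert v) else 0) +
      (if word_degree w = word_degree w0 then 0 else ?g * Poly_Mapping.single w (?c w)))"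
  proof (rule lpa_eq_sum)
    fix w assume "w \<in> Poly_Mapping.keys a"
    then obtain u' p' v' where p': "awalk u' p' v'" "w = path_word u' p'"
      using path by blast
    show "?g * Poly_Mapping.single w (?c w) \<doteq> (if w = w0 then Poly_Mapping.single 0 (?c w) * gen (Vert v) else 0) +
      (if word_degree w = word_degree w0 then 0 else ?g * Poly_Mapping.single w (?c w))"
    proof (cases "length p' = length p")
      case True
      then show ?thesis
        using ghost_path_path_word[OF p(1) p'(1), of "?c w"] p(2) p'(2) by auto
    next
      case False
      then show ?thesis
        using p(2) p'(2) by (auto simp: path_word_eq_iff)
    qed
  qed
  also have "\<dots> = Poly_Mapping.single 0 (?c w0) * gen (Vert v) + z"
    using w0(1) by (simp add: sum.distrib z_def)
  finally have "?g * a \<doteq> Poly_Mapping.single 0 (?c w0) * gen (Vert v) + z" .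
  moreover have "z \<in> positive_part"
    unfolding z_def
  proof (rule positive_part_sum)
    fix w assume w: "w \<in> Poly_Mapping.keys a"
    then obtain u' p' v' where p': "awalk u' p' v'" "w = path_word u' p'"
      using path by blast
    then have "0 < word_degree (ghost_path u p + w)" if "word_degree w \<noteq> word_degree w0"
      using w0(2)[OF w] p(2) that by (simp add: word_degree_plus)
    then show "(if word_degree w = word_degree w0 then 0 else ?g * Poly_Mapping.single w (?c w)) \<in> positive_part"
      by (auto simp: positive_part_def mult_single split: if_splits)
  qed
  moreover have "?c w0 \<noteq> 0"
    using w0 by (simp add: in_keys_iff)
  moreover have "v \<in> verts G" "?g \<in> carrier (free_algebra (generators G))"
    using p(1) free_algebra_ghost_path by auto
  ultimately show thesis
    by (intro that)
qed

lemma leading_coefficient: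
  assumes x: "x \<in> carrier (free_algebra (generators G))" "\<not> x \<doteq> 0"
  obtains g q v r z where "g \<in> carrier (free_algebra (generators G))" "q \<in> carrier (free_algebra (generators G))"
    "v \<in> verts G" "r \<noteq> 0" "z \<in> positive_part" "g * x * q \<doteq> Poly_Mapping.single 0 r * gen (Vert v) + z"
proof -
  obtain n where "x \<in> ghost_span n"
    using x free_algebra_ghost_span by blast
  then obtain q a where q: "q \<in> carrier (free_algebra (generators G))" and a: "a \<in> path_span" "a \<noteq> 0" "x * q \<doteq> a"
    using reduce_to_path_span x by blast
  obtain g v r z where g: "g \<in> carrier (free_algebra (generators G))" "v \<in> verts G" "r \<noteq> 0" "z \<in> positive_part"
      "g * a \<doteq> Poly_Mapping.single 0 r * gen (Vert v) + z"
    using path_span_leading_coefficient[OF a(1,2)] by blast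
  have "g * x * q = g * (x * q)"
    by (rule mult.assoc)
  also have "\<dots> \<doteq> g * a"
    by (rule lpa_eq_lmult) (rule a)
  also note g(5)
  finally show thesis
    using that g q by blast
qed

text \<open>Multiplying by the ghost path on the left and by the path on the right turns v into w
  and changes degrees by - |p| + |p| = 0, so the remainder stays positive.\<close>

lemma transport_leading_coefficient:
  fixes z :: "('a, 'b) generator fword \<Rightarrow>\<^sub>0 'r::ring_1"
  assumes p: "awalk v p w" and z: "z \<in> positive_part"
  obtains z' where "z' \<in> positive_part"
    "Poly_Mapping.single (ghost_path v p) 1 * (Poly_Mapping.single 0 r * gen (Vert v) + z) * Poly_Mapping.single (path_word v p) 1
      \<doteq> Poly_Mapping.single 0 r * gen (Vert w) + z'"
proof
  let ?g = "Poly_Mapping.single (ghost_path v p) 1 :: ('a, 'b) generator fword \<Rightarrow>\<^sub>0 'r"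
  let ?h = "Poly_Mapping.single (path_word v p) 1 :: ('a, 'b) generator fword \<Rightarrow>\<^sub>0 'r"
  show "?g * z * ?h \<in> positive_part"
    using z unfolding positive_part_def
    by (auto simp: word_degree_plus elim!: keys_multE split: if_splits)
  have "gen (Vert v) * ?h = gen (Vert v) * gen (Vert v) * Poly_Mapping.single (FWord (map Edge p)) 1"
    by (simp add: path_word_def gen_mult_single mult.assoc)
  also have "\<dots> \<doteq> gen (Vert v) * Poly_Mapping.single (FWord (map Edge p)) 1"
    using vert_vert[of v v] p by (intro lpa_eq_rmult) auto
  also have "\<dots> = ?h"
    by (simp add: path_word_def gen_mult_single)
  finally have h: "gen (Vert v) * ?h \<doteq> ?h" .
  have "?g * (Poly_Mapping.single 0 r * gen (Vert v) + z) * ?h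
      = ?g * Poly_Mapping.single 0 r * (gen (Vert v) * ?h) + ?g * z * ?h"
    by (simp add: distrib_left distrib_right mult.assoc)
  \<comment> \<open>The scalar r passes the ghost path because that word has coefficient 1.\<close>
  also have "\<dots> = Poly_Mapping.single 0 r * (?g * (gen (Vert v) * ?h)) + ?g * z * ?h"
    by (simp only: mult.assoc flip: scalar_commute)
  also have "\<dots> \<doteq> Poly_Mapping.single 0 r * (?g * ?h) + ?g * z * ?h"
    by (intro lpa_eq_add lpa_eq_lmult h lpa_eq_refl)
  also have "\<dots> \<doteq> Poly_Mapping.single 0 r * gen (Vert w) + ?g * z * ?h"
    using ghost_path_path_word[OF p p refl, of "1 :: 'r"] by (intro lpa_eq_add lpa_eq_lmult lpa_eq_refl) simp
  finally show "?g * (Poly_Mapping.single 0 r * gen (Vert v) + z) * ?h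
    \<doteq> Poly_Mapping.single 0 r * gen (Vert w) + ?g * z * ?h" .
qed

text \<open>Degree zero occurs only in the product of the two vertex terms; every other term has a
  factor of positive degree and one of nonnegative degree.\<close>

lemma leading_coefficient_mult:
  fixes z z' :: "('a, 'b) generator fword \<Rightarrow>\<^sub>0 'r::ring_1"
  assumes w: "w \<in> verts G" and z: "z \<in> positive_part" "z' \<in> positive_part"
  obtains y where "y \<in> positive_part"
    "(Poly_Mapping.single 0 r * gen (Vert w) + z) * Poly_Mapping.single 0 c * (Poly_Mapping.single 0 s * gen (Vert w) + z')
      \<doteq> Poly_Mapping.single 0 (r * c * s) * gen (Vert w) + y"
proof
  let ?S = "\<lambda>c. Poly_Mapping.single 0 c :: ('a, 'b) generator fword \<Rightarrow>\<^sub>0 'r"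
  let ?w = "gen (Vert w) :: ('a, 'b) generator fword \<Rightarrow>\<^sub>0 'r"
  let ?y = "(?S r * ?w * ?S c) * z' + z * (?S c * (?S s * ?w)) + z * (?S c * z')"
  have deg0: "0 \<le> word_degree u" if "u \<in> Poly_Mapping.keys (?S r * ?w * ?S c)" for u
    using that by (auto simp: gen_def mult_single word_degree_def split: if_splits)
  have deg1: "0 \<le> word_degree u" if "u \<in> Poly_Mapping.keys (?S c * (?S s * ?w))" for u
    using that by (auto simp: gen_def mult_single word_degree_def split: if_splits)
  have deg2: "0 \<le> word_degree u" if "u \<in> Poly_Mapping.keys (?S c * z')" for u
    using that z(2) keys_scalar_mult[of c z'] by (force simp: positive_part_def)
  show "?y \<in> positive_part"
    using z by (intro positive_part_add positive_part_mult deg0 deg1 deg2)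
  have "?S r * ?w * ?S c * (?S s * ?w) = ?S (r * c * s) * (?w * ?w)"
    by (simp add: gen_def mult_single)
  also have "\<dots> \<doteq> ?S (r * c * s) * ?w"
    using vert_vert[OF w w] by (intro lpa_eq_lmult) simp
  finally have "?S r * ?w * ?S c * (?S s * ?w) + ?y \<doteq> ?S (r * c * s) * ?w + ?y"
    by (intro lpa_eq_add lpa_eq_refl)
  moreover have "(?S r * ?w + z) * ?S c * (?S s * ?w + z') = ?S r * ?w * ?S c * (?S s * ?w) + ?y"
    by (simp add: distrib_left distrib_right mult.assoc)
  ultimately show "(?S r * ?w + z) * ?S c * (?S s * ?w + z') \<doteq> ?S (r * c * s) * ?w + ?y"
    by simp
qed

end

section \<open>The primeness criterion\<close>

lemma prime_ring_of_type_algebra_iff: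
  "prime_ring (ring_of_type_algebra :: 'r::ring_1 ring) \<longleftrightarrow>
    (\<forall>r s :: 'r. (\<forall>t. r * t * s = 0) \<longrightarrow> r = 0 \<or> s = 0)"
proof -
  have "abelian_group (ring_of_type_algebra :: 'r ring)"
    by (rule abelian_groupI) (auto simp: ring_of_type_algebra_def add_ac intro: exI[of _ "- _"])
  then interpret nonunital_ring "ring_of_type_algebra :: 'r ring"
    by (intro nonunital_ring.intro nonunital_ring_axioms.intro)
      (auto simp: ring_of_type_algebra_def mult.assoc distrib_left distrib_right)
  have "UNIV \<noteq> {0 :: 'r}"
    using one_neq_zero by blast
  then show ?thesis
    unfolding prime_ring_iff by (simp add: ring_of_type_algebra_def)
qed

context wf_digraph
begin

text \<open>Restates primeness entirely by congruences between polynomials, the form used in both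
  directions of the theorem.\<close>

lemma prime_leavitt_path_algebra_iff:
  "prime_ring (leavitt_path_algebra TYPE('r::ring_1) G) \<longleftrightarrow>
    (\<exists>x\<in>carrier (free_algebra (generators G)). \<not> x \<doteq> (0 :: ('a, 'b) generator fword \<Rightarrow>\<^sub>0 'r)) \<and>
    (\<forall>x\<in>carrier (free_algebra (generators G)). \<forall>y\<in>carrier (free_algebra (generators G)).
      (\<forall>t\<in>carrier (free_algebra (generators G)). x * t * y \<doteq> (0 :: ('a, 'b) generator fword \<Rightarrow>\<^sub>0 'r)) \<longrightarrow>
      x \<doteq> 0 \<or> y \<doteq> 0)"
proof -
  interpret nonunital_ring "free_algebra (generators G) :: (('a, 'b) generator fword \<Rightarrow>\<^sub>0 'r) ring"
    by (rule nonunital_ring_free_algebra)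
  let ?F = "carrier (free_algebra (generators G)) :: (('a, 'b) generator fword \<Rightarrow>\<^sub>0 'r) set"
  let ?J = "algebra_ideal (generators G) (leavitt_relations G) :: (('a, 'b) generator fword \<Rightarrow>\<^sub>0 'r) set"
  have J: "x \<in> ?J \<longleftrightarrow> x \<doteq> 0" if "x \<in> ?F" for x
    using that by (simp add: lpa_eq_zero_iff null_elements_iff)
  have "?F \<noteq> ?J \<longleftrightarrow> (\<exists>x\<in>?F. \<not> x \<doteq> 0)"
    using J algebra_ideal_subset[OF leavitt_relations_subset] by blast
  moreover have "x * t * y \<in> ?J \<longleftrightarrow> x * t * y \<doteq> 0" if "x \<in> ?F" "y \<in> ?F" "t \<in> ?F" for x y t
    using that by (intro J free_algebra_mult)
  ultimately show ?thesis
    unfolding leavitt_path_algebra_def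
      prime_ring_FactRing_iff[OF two_sided_ideal_algebra_ideal[OF leavitt_relations_subset]]
    by (simp add: J)
qed

section \<open>Necessity of the two conditions\<close>

lemma scalar_vert_zero_iff:
  assumes "v \<in> verts G"
  shows "Poly_Mapping.single 0 r * gen (Vert v) \<doteq> 0 \<longleftrightarrow> r = 0"
  using vert_plus_positive_nonzero[OF assms positive_part_zero, of r] by auto

lemma vert_nonzero: "v \<in> verts G \<Longrightarrow> \<not> gen (Vert v) \<doteq> (0 :: ('a, 'b) generator fword \<Rightarrow>\<^sub>0 'r::ring_1)"
  using scalar_vert_zero_iff[of v "1 :: 'r"] by simp

text \<open>Multiplication by v on the right keeps the paths ending at v, and multiplication by u on
  the left kills those that do not start at u.\<close>

lemma vert_mult_path_span_nonzero:
  assumes a: "a \<in> path_span" and "u \<in> verts G" "v \<in> verts G" "\<not> gen (Vert u) * a * gen (Vert v) \<doteq> 0"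
  shows "\<exists>p. awalk u p v"
proof (rule ccontr)
  assume no_path: "\<nexists>p. awalk u p v"
  let ?c = "Poly_Mapping.lookup a"
  let ?K = "{w \<in> Poly_Mapping.keys a. path_word_to v w}"
  have "gen (Vert u) * a * gen (Vert v) = gen (Vert u) * (a * gen (Vert v))"
    by (rule mult.assoc)
  also have "\<dots> \<doteq> gen (Vert u) * restrict_words (path_word_to v) a"
    using assms by (intro lpa_eq_lmult path_span_mult_vert)
  also have "\<dots> = (\<Sum>w\<in>?K. gen (Vert u) * Poly_Mapping.single w (?c w))"
    by (simp add: restrict_words_def sum_distrib_left)
  also have "\<dots> \<doteq> (\<Sum>w\<in>?K. 0)"
  proof (rule lpa_eq_sum)
    fix w assume "w \<in> ?K"
    then obtain u' p where p: "awalk u' p v" "w = path_word u' p"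
      by (auto simp: path_word_to_def)
    then have "u \<noteq> u'" using no_path by blast
    have "gen (Vert u) * Poly_Mapping.single w (?c w)
        = gen (Vert u) * gen (Vert u') * Poly_Mapping.single (FWord (map Edge p)) (?c w)"
      by (simp add: p path_word_def gen_mult_single mult.assoc)
    also have "\<dots> \<doteq> 0 * Poly_Mapping.single (FWord (map Edge p)) (?c w)"
      using vert_vert[of u u'] \<open>u \<noteq> u'\<close> assms p by (intro lpa_eq_rmult) auto
    finally show "gen (Vert u) * Poly_Mapping.single w (?c w) \<doteq> 0"
      by simp
  qed
  finally show False
    using assms by simp
qed

text \<open>Each step peels off the last ghost letter f, whose tail must be v, and continues with
  the head of f in place of v. The peeled arcs form the walk from v; as soon as the path part is not
  annihilated, it gives a walk from u to the current vertex.\<close>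

lemma common_descendant:
  assumes "x \<in> ghost_span n" "u \<in> verts G" "v \<in> verts G" "\<not> gen (Vert u) * x * gen (Vert v) \<doteq> 0"
  shows "\<exists>w p q. awalk u p w \<and> awalk v q w"
  using assms
proof (induction n arbitrary: x v)
  case 0
  then obtain a where a: "a \<in> path_span" "x \<doteq> a"
    by auto
  then have "gen (Vert u) * x * gen (Vert v) \<doteq> gen (Vert u) * a * gen (Vert v)"
    by (intro lpa_eq_rmult lpa_eq_lmult)
  then have "\<not> gen (Vert u) * a * gen (Vert v) \<doteq> 0"
    using 0 lpa_eq_trans by blast
  then show ?case
    using vert_mult_path_span_nonzero[OF a(1)] 0 awalk_Nil_iff by metis
next
  case (Suc n)
  obtain a F b where x: "a \<in> path_span" "finite F" "F \<subseteq> arcs G" "\<And>f. f \<in> F \<Longrightarrow> b f \<in> ghost_span n"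
      "x \<doteq> a + (\<Sum>f\<in>F. b f * gen (Ghost f))"
    using ghost_span_SucE[OF Suc.prems(1)] by blast
  show ?case
  proof (cases "gen (Vert u) * a * gen (Vert v) \<doteq> 0")
    case False
    then show ?thesis
      using vert_mult_path_span_nonzero[OF x(1)] Suc.prems awalk_Nil_iff by metis
  next
    case True
    have "\<exists>f\<in>F. tail G f = v \<and> \<not> gen (Vert u) * b f * gen (Vert (head G f)) \<doteq> 0"
    proof (rule ccontr)
      assume *: "\<not> ?thesis"
      have "gen (Vert u) * x * gen (Vert v) \<doteq> gen (Vert u) * (a + (\<Sum>f\<in>F. b f * gen (Ghost f))) * gen (Vert v)"
        using x(5) by (intro lpa_eq_rmult lpa_eq_lmult)
      also have "\<dots> = gen (Vert u) * a * gen (Vert v) + gen (Vert u) * ((\<Sum>f\<in>F. b f * gen (Ghost f)) * gen (Vert v))"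
        by (simp add: distrib_left distrib_right mult.assoc)
      also have "\<dots> \<doteq> 0 + gen (Vert u) * (\<Sum>f\<in>F. if tail G f = v then b f * gen (Ghost f) else 0)"
        using x Suc.prems by (intro lpa_eq_add True lpa_eq_lmult ghost_sum_mult_vert)
      also have "\<dots> = (\<Sum>f\<in>F. gen (Vert u) * (if tail G f = v then b f * gen (Ghost f) else 0))"
        by (simp add: sum_distrib_left)
      also have "\<dots> \<doteq> (\<Sum>f\<in>F. 0)"
      proof (rule lpa_eq_sum)
        fix f assume f: "f \<in> F"
        have "gen (Vert u) * b f * gen (Ghost f) \<doteq> 0" if "tail G f = v"
          by (rule ghost_cancel) (use * f x(3) that in auto)
        then show "gen (Vert u) * (if tail G f = v then b f * gen (Ghost f) else 0) \<doteq> 0"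
          by (simp add: mult.assoc)
      qed
      finally show False
        using Suc.prems by simp
    qed
    then obtain f where f: "f \<in> F" "tail G f = v" "\<not> gen (Vert u) * b f * gen (Vert (head G f)) \<doteq> 0"
      by blast
    moreover have "f \<in> arcs G"
      using f x by blast
    ultimately obtain w p q where "awalk u p w" "awalk (head G f) q w"
      using Suc.IH[of "b f" "head G f"] x(4) Suc.prems(2) by auto
    then have "awalk u p w" "awalk v (f # q) w"
      using f \<open>f \<in> arcs G\<close> by (auto simp: awalk_Cons_iff)
    then show ?thesis by blast
  qed
qed

lemma MT3_if_prime:
  assumes "prime_ring (leavitt_path_algebra TYPE('r::ring_1) G)"
  shows "MT3 G"
  unfolding MT3_def
proof (intro ballI)
  fix u v assume uv: "u \<in> verts G" "v \<in> verts G"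
  let ?F = "carrier (free_algebra (generators G)) :: (('a, 'b) generator fword \<Rightarrow>\<^sub>0 'r) set"
  have "gen (Vert u) \<in> ?F" "gen (Vert v) \<in> ?F"
    using uv by (simp_all add: free_algebra_generators)
  then obtain t where t: "t \<in> ?F" "\<not> gen (Vert u) * t * gen (Vert v) \<doteq> 0"
    using assms vert_nonzero uv unfolding prime_leavitt_path_algebra_iff by blast
  then show "\<exists>w\<in>verts G. (\<exists>p. awalk u p w) \<and> (\<exists>q. awalk v q w)"
    using free_algebra_ghost_span[OF t(1)] common_descendant uv awalk_last_in_verts by metis
qed

lemma scalars_prime_if_prime:
  assumes "verts G \<noteq> {}" "prime_ring (leavitt_path_algebra TYPE('r::ring_1) G)"
    and rs: "\<And>t. r * t * s = (0 :: 'r)"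
  shows "r = 0 \<or> s = 0"
proof -
  obtain v where v: "v \<in> verts G"
    using assms by blast
  let ?F = "carrier (free_algebra (generators G)) :: (('a, 'b) generator fword \<Rightarrow>\<^sub>0 'r) set"
  let ?v = "\<lambda>c. Poly_Mapping.single 0 c * gen (Vert v) :: ('a, 'b) generator fword \<Rightarrow>\<^sub>0 'r"
  have "?v r \<in> ?F" "?v s \<in> ?F"
    using v by (simp_all add: free_algebra_generators free_algebra_scalar_mult)
  \<comment> \<open>This holds as an identity of polynomials: scalars commute with words, so every
    coefficient of the product has the form r c s.\<close>
  moreover have "?v r * t * ?v s = 0" for t
    by (induction t rule: poly_mapping_add_induct)
      (simp_all add: gen_def mult_single rs distrib_left distrib_right)
  ultimately have "?v r \<doteq> 0 \<or> ?v s \<doteq> 0"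
    using assms(2) unfolding prime_leavitt_path_algebra_iff by (metis lpa_eq_refl)
  then show ?thesis
    using v by (simp add: scalar_vert_zero_iff)
qed

section \<open>Sufficiency of the two conditions\<close>

lemma prime_if_scalars_prime_MT3:
  assumes "verts G \<noteq> {}" and MT3: "MT3 G"
    and R: "\<And>r s :: 'r::ring_1. (\<And>t. r * t * s = 0) \<Longrightarrow> r = 0 \<or> s = 0"
  shows "prime_ring (leavitt_path_algebra TYPE('r) G)"
  unfolding prime_leavitt_path_algebra_iff
proof (intro conjI ballI impI)
  let ?F = "carrier (free_algebra (generators G)) :: (('a, 'b) generator fword \<Rightarrow>\<^sub>0 'r) set"
  show "\<exists>x\<in>?F. \<not> x \<doteq> 0"
    using assms(1) vert_nonzero free_algebra_generators(1) by blast
  fix x y assume x: "x \<in> ?F" and y: "y \<in> ?F" and xy: "\<forall>t\<in>?F. x * t * y \<doteq> 0"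
  show "x \<doteq> 0 \<or> y \<doteq> 0"
  proof (rule ccontr)
    assume "\<not> (x \<doteq> 0 \<or> y \<doteq> 0)"
    then have nz: "\<not> x \<doteq> 0" "\<not> y \<doteq> 0" by auto
    obtain g q v r z where X: "g \<in> ?F" "q \<in> ?F" "v \<in> verts G" "r \<noteq> 0" "z \<in> positive_part"
        "g * x * q \<doteq> Poly_Mapping.single 0 r * gen (Vert v) + z"
      using leading_coefficient[OF x nz(1)] by blast
    obtain g' q' v' s z' where Y: "g' \<in> ?F" "q' \<in> ?F" "v' \<in> verts G" "s \<noteq> 0" "z' \<in> positive_part"
        "g' * y * q' \<doteq> Poly_Mapping.single 0 s * gen (Vert v') + z'"
      using leading_coefficient[OF y nz(2)] by blast
    obtain w p p' where w: "w \<in> verts G" "awalk v p w" "awalk v' p' w"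
      using MT3 X(3) Y(3) unfolding MT3_def by blast
    obtain c where c: "r * c * s \<noteq> 0"
      using R[of r s] X(4) Y(4) by blast
    let ?S = "\<lambda>c. Poly_Mapping.single 0 c :: ('a, 'b) generator fword \<Rightarrow>\<^sub>0 'r"
    define a where "a = (Poly_Mapping.single (ghost_path v p) 1 :: ('a, 'b) generator fword \<Rightarrow>\<^sub>0 'r)"
    define b where "b = (Poly_Mapping.single (path_word v p) 1 :: ('a, 'b) generator fword \<Rightarrow>\<^sub>0 'r)"
    define a' where "a' = (Poly_Mapping.single (ghost_path v' p') 1 :: ('a, 'b) generator fword \<Rightarrow>\<^sub>0 'r)"
    define b' where "b' = (Poly_Mapping.single (path_word v' p') 1 :: ('a, 'b) generator fword \<Rightarrow>\<^sub>0 'r)"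
    obtain h where h: "h \<in> positive_part"
        "a * (?S r * gen (Vert v) + z) * b \<doteq> ?S r * gen (Vert w) + h"
      using transport_leading_coefficient[OF w(2) X(5)] unfolding a_def b_def by blast
    obtain h' where h': "h' \<in> positive_part"
        "a' * (?S s * gen (Vert v') + z') * b' \<doteq> ?S s * gen (Vert w) + h'"
      using transport_leading_coefficient[OF w(3) Y(5)] unfolding a'_def b'_def by blast
    obtain k where k: "k \<in> positive_part"
        "(?S r * gen (Vert w) + h) * ?S c * (?S s * gen (Vert w) + h') \<doteq> ?S (r * c * s) * gen (Vert w) + k"
      using leading_coefficient_mult[OF w(1) h(1) h'(1)] by blast
    have left: "a * (g * x * q) * b \<doteq> ?S r * gen (Vert w) + h"
      using lpa_eq_trans[OF lpa_eq_rmult[OF lpa_eq_lmult[OF X(6)]] h(2)] .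
    have right: "a' * (g' * y * q') * b' \<doteq> ?S s * gen (Vert w) + h'"
      using lpa_eq_trans[OF lpa_eq_rmult[OF lpa_eq_lmult[OF Y(6)]] h'(2)] .
    have "a * (g * x * q) * b * ?S c * (a' * (g' * y * q') * b')
        \<doteq> (?S r * gen (Vert w) + h) * ?S c * (a' * (g' * y * q') * b')"
      by (intro lpa_eq_rmult left)
    also have "\<dots> \<doteq> (?S r * gen (Vert w) + h) * ?S c * (?S s * gen (Vert w) + h')"
      by (intro lpa_eq_lmult right)
    also note k(2)
    finally have "a * (g * x * q) * b * ?S c * (a' * (g' * y * q') * b') \<doteq> ?S (r * c * s) * gen (Vert w) + k" .
    then have "?S (r * c * s) * gen (Vert w) + k \<doteq> a * (g * x * q) * b * ?S c * (a' * (g' * y * q') * b')"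
      by (rule lpa_eq_sym)
    \<comment> \<open>Regrouping exhibits one factor between x and y. The scalar c is attached to
      a', since a scalar alone, having the empty word, is not in the algebra.\<close>
    also have "\<dots> = (a * g) * (x * (q * b * (?S c * a') * g') * y) * (q' * b')"
      by (simp only: mult.assoc)
    also have "\<dots> \<doteq> (a * g) * 0 * (q' * b')"
    proof (intro lpa_eq_rmult lpa_eq_lmult xy[rule_format])
      have "b \<in> ?F" "a' \<in> ?F"
        unfolding b_def a'_def using w free_algebra_path_word free_algebra_ghost_path by blast+
      then show "q * b * (?S c * a') * g' \<in> ?F"
        using X Y by (intro free_algebra_mult free_algebra_scalar_mult)
    qed
    finally have "?S (r * c * s) * gen (Vert w) + k \<doteq> 0"
      by simp
    then show False
      using vert_plus_positive_nonzero[OF w(1) k(1) c] by blast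
  qed
qed

end

theorem theorem1p6:
  fixes E :: "('v, 'e) pre_digraph"
  assumes "wf_digraph E" and "verts E \<noteq> {}"
  shows "prime_ring (leavitt_path_algebra TYPE('r::ring_1) E) \<longleftrightarrow>
    prime_ring (ring_of_type_algebra :: 'r ring) \<and> MT3 E"
proof -
  interpret wf_digraph E by fact
  show ?thesis
    unfolding prime_ring_of_type_algebra_iff
    using MT3_if_prime scalars_prime_if_prime[OF assms(2)] prime_if_scalars_prime_MT3[OF assms(2)]
    by blast
qed

end
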